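(* Let $(X,\leq)$ be a linearly ordered set (respectively, $(X,\circ)$ a circularly ordered set), and let $G$ be a subgroup of $\mathrm{Aut}(X,\leq)$ (respectively, of $\mathrm{Aut}(X,\circ)$) endowed with the pointwise topology. Then $G$ is an orderly (respectively, c-orderly) topological group.
   Context: $\mathrm{Aut}(X,\leq)$ is the group of all bijections $g$ of $X$ with $x\leq y\Leftrightarrow gx\leq gy$; $\mathrm{Aut}(X,\circ)$ is the group of all bijections $g$ of $X$ with $[x,y,z]\Leftrightarrow[gx,gy,gz]$. The pointwise topology is the topology of pointwise convergence where $X$ is regarded as a discrete space. A circular order on $X$ is a ternary relation $R\subset X^3$ (write $[a,b,c]$ for $(a,b,c)\in R$) such that: (Cyclicity) $[a,b,c]\Rightarrow[b,c,a]$; (Asymmetry) $[a,b,c]\Rightarrow (b,a,c)\notin R$; (Transitivity) $[a,b,c]$ and $[a,c,d]$ imply $[a,b,d]$; (Totality) if $a,b,c$ are distinct then $[a,b,c]$ or $[a,c,b]$. Put $(a,b)_\circ=\{x: [a,x,b]\}$ and $[a,b]_\circ=(a,b)_\circ\cup\{a,b\}$. The circular topology has base $\{X\setminus[a,b]_\circ: a,b\in X\}\cup\{X\}$. The interval topology of a linearly ordered set has as subbase all rays $\{x: a<x\}$, $\{x: x<b\}$. A compact linearly (circularly) ordered space is a linearly (circularly) ordered set whose interval (circular) topology is compact, equipped with that topology. For such a space $K$, $H_+(K)$ is the group of all homeomorphisms of $K$ preserving the linear (respectively circular) order, with the compact-open topology. A topological group is orderly (c-orderly) if it embeds as a topological group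 into $H_+(K)$ for some compact linearly (circularly) ordered space $K$. *)

theory Defs
  imports "HOL-Analysis.Analysis" "HOL-Algebra.Bij"
begin

section \<open>Linearly and circularly ordered spaces\<close>

text \<open>A linearly ordered set is a carrier \<open>X\<close> with a relation \<open>r\<close> such that
  \<^term>\<open>linear_order_on X r\<close>; thus \<open>(x, y) \<in> r\<close> means \<open>x \<le> y\<close>.\<close>

text \<open>The whole space is added to the subbase of rays, since otherwise a one-point order
  would have no nonempty ray and hence empty topological space.\<close>

definition interval_topology :: "'a set \<Rightarrow> 'a rel \<Rightarrow> 'a topology" where
  "interval_topology X r = topology_generated_by
     (insert X ({{x \<in> X. (a, x) \<in> r \<and> x \<noteq> a} |a. a \<in> X} \<union>
                {{x \<in> X. (x, b) \<in> r \<and> x \<noteq> b} |b. b \<in> X}))"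

definition compact_linearly_ordered_space :: "'a set \<Rightarrow> 'a rel \<Rightarrow> bool" where
  "compact_linearly_ordered_space X r \<longleftrightarrow>
     linear_order_on X r \<and> compact_space (interval_topology X r)"

definition circular_order_on :: "'a set \<Rightarrow> ('a \<times> 'a \<times> 'a) set \<Rightarrow> bool" where
  "circular_order_on X R \<longleftrightarrow>
     R \<subseteq> X \<times> X \<times> X \<and>
     (\<forall>a b c. (a, b, c) \<in> R \<longrightarrow> (b, c, a) \<in> R) \<and>
     (\<forall>a b c. (a, b, c) \<in> R \<longrightarrow> (b, a, c) \<notin> R) \<and>
     (\<forall>a b c d. (a, b, c) \<in> R \<longrightarrow> (a, c, d) \<in> R \<longrightarrow> (a, b, d) \<in> R) \<and>
     (\<forall>a\<in>X. \<forall>b\<in>X. \<forall>c\<in>X. a \<noteq> b \<longrightarrow> b \<noteq> c \<longrightarrow> a \<noteq> c \<longrightarrow> (a, b, c) \<in> R \<or> (a, c, b) \<in> R)"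

definition open_arc :: "('a \<times> 'a \<times> 'a) set \<Rightarrow> 'a \<Rightarrow> 'a \<Rightarrow> 'a set" where
  "open_arc R a b = {x. (a, x, b) \<in> R}"

definition closed_arc :: "('a \<times> 'a \<times> 'a) set \<Rightarrow> 'a \<Rightarrow> 'a \<Rightarrow> 'a set" where
  "closed_arc R a b = open_arc R a b \<union> {a, b}"

definition circular_base :: "'a set \<Rightarrow> ('a \<times> 'a \<times> 'a) set \<Rightarrow> 'a set set" where
  "circular_base X R = insert X {X - closed_arc R a b |a b. a \<in> X \<and> b \<in> X}"

text \<open>For a circular order the generating family is a base, as
  \<open>openin_circular_topology\<close> below shows.\<close>

definition circular_topology :: "'a set \<Rightarrow> ('a \<times> 'a \<times> 'a) set \<Rightarrow> 'a topology" where
  "circular_topology X R = topology_generated_by (circular_base X R)"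

definition compact_circularly_ordered_space :: "'a set \<Rightarrow> ('a \<times> 'a \<times> 'a) set \<Rightarrow> bool" where
  "compact_circularly_ordered_space X R \<longleftrightarrow>
     circular_order_on X R \<and> compact_space (circular_topology X R)"

lemma circular_base_Int:
  assumes R: "circular_order_on X R"
    and B: "B \<in> circular_base X R" "C \<in> circular_base X R" and x: "x \<in> B \<inter> C"
  shows "\<exists>D\<in>circular_base X R. x \<in> D \<and> D \<subseteq> B \<inter> C"
proof (cases "B = X \<or> C = X")
  case True
  have "B \<subseteq> X" "C \<subseteq> X" using B by (auto simp: circular_base_def)
  with True have "B \<inter> C = B \<or> B \<inter> C = C" by blast
  then show ?thesis using B x by (metis order_refl)
next
  case False
  then obtain a b c d where ab: "a \<in> X" "b \<in> X" "B = X - closed_arc R a b"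
    and cd: "c \<in> X" "d \<in> X" "C = X - closed_arc R c d"
    using B unfolding circular_base_def by blast
  note R' = R[unfolded circular_order_on_def]
  have sub: "R \<subseteq> X \<times> X \<times> X" using R' by (rule conjunct1)
  have cyc: "(b, c, a) \<in> R" if "(a, b, c) \<in> R" for a b c
    using R'[THEN conjunct2, THEN conjunct1] that by simp
  have asym: "(b, a, c) \<notin> R" if "(a, b, c) \<in> R" for a b c
    using R'[THEN conjunct2, THEN conjunct2, THEN conjunct1] that by simp
  have tr: "(a, b, d) \<in> R" if "(a, b, c) \<in> R" "(a, c, d) \<in> R" for a b c d
    using R'[THEN conjunct2, THEN conjunct2, THEN conjunct2, THEN conjunct1,
      rule_format, OF that] .
  have tot: "(a, b, c) \<in> R \<or> (a, c, b) \<in> R"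
    if "a \<in> X" "b \<in> X" "c \<in> X" "a \<noteq> b" "b \<noteq> c" "a \<noteq> c" for a b c
    using R'[THEN conjunct2, THEN conjunct2, THEN conjunct2, THEN conjunct2,
      rule_format, OF that] .
  have irr: "(a, b, b) \<notin> R" "(b, b, a) \<notin> R" "(b, a, b) \<notin> R" for a b
    using asym[of b b a] cyc[of a b b] cyc[of b a b] by blast+
  define le where "le y z \<longleftrightarrow> y = z \<or> (x, y, z) \<in> R" for y z
  have xX: "x \<in> X" using x ab by blast
  have le_trans: "le u w" if "le u v" "le v w" for u v w
    using that tr unfolding le_def by metis
  have le_total: "le u v \<or> le v u" if "u \<in> X - {x}" "v \<in> X - {x}" for u v
    using that tot[OF xX, of u v] unfolding le_def by blast
  have arcs: "x \<notin> closed_arc R u v \<longleftrightarrow> le u v" if "u \<in> X - {x}" "v \<in> X - {x}" for u v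
  proof -
    have "x \<in> closed_arc R u v \<longleftrightarrow> (u, x, v) \<in> R"
      using that by (auto simp: closed_arc_def open_arc_def)
    moreover have "(u, x, v) \<in> R \<longleftrightarrow> (x, v, u) \<in> R"
      using cyc[of u x v] cyc[of x v u] cyc[of v u x] by blast
    moreover have "(x, v, u) \<in> R \<longleftrightarrow> \<not> le u v"
    proof (cases "u = v")
      case True
      show ?thesis using True irr by (simp add: le_def)
    next
      case False
      have "(x, u, v) \<in> R \<Longrightarrow> (x, v, u) \<notin> R" using cyc[of x u v] cyc[of u v x] asym[of v x u] by blast
      then show ?thesis using that tot[OF xX, of u v] False by (auto simp: le_def)
    qed
    ultimately show ?thesis by blast
  qed
  have mem: "y \<in> closed_arc R u v \<longleftrightarrow> y \<in> X - {x} \<and> le u y \<and> le y v"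
    if uv: "u \<in> X - {x}" "v \<in> X - {x}" "le u v" for u v y
  proof
    assume y: "y \<in> closed_arc R u v"
    have yx: "y \<noteq> x" using arcs uv y by blast
    have yX: "y \<in> X" using y sub uv by (auto simp: closed_arc_def open_arc_def)
    show "y \<in> X - {x} \<and> le u y \<and> le y v"
    proof (cases "y = u \<or> y = v")
      case True
      then show ?thesis using uv unfolding le_def by blast
    next
      case ne: False
      then have uyv: "(u, y, v) \<in> R" using y by (auto simp: closed_arc_def open_arc_def)
      then have "u \<noteq> v" using irr by blast
      then have "(u, v, x) \<in> R" using uv(3) cyc[of x u v] unfolding le_def by blast
      then have "(u, y, x) \<in> R" using tr[OF uyv] by blast
      moreover have "(v, x, y) \<in> R"
        using tr[OF cyc[OF \<open>(u, v, x) \<in> R\<close>] cyc[OF cyc[OF uyv]]] .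
      ultimately show ?thesis using yx yX cyc[of u y x] cyc[of y x u] cyc[of v x y] unfolding le_def by blast
    qed
  next
    assume y: "y \<in> X - {x} \<and> le u y \<and> le y v"
    show "y \<in> closed_arc R u v"
    proof (cases "y = u \<or> y = v")
      case True
      then show ?thesis by (auto simp: closed_arc_def)
    next
      case ne: False
      then have "(x, u, y) \<in> R" "(x, y, v) \<in> R" using y unfolding le_def by blast+
      then have "(y, v, u) \<in> R" using tr[OF cyc cyc[OF cyc]] by blast
      then have "(u, y, v) \<in> R" using cyc[OF cyc] by blast
      then show ?thesis by (auto simp: closed_arc_def open_arc_def)
    qed
  qed
  have pts: "a \<in> X - {x}" "b \<in> X - {x}" "c \<in> X - {x}" "d \<in> X - {x}"
    using x ab cd by (auto simp: closed_arc_def)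
  have leab: "le a b" and lecd: "le c d" using arcs pts x ab cd by blast+
  obtain p where p: "p \<in> X - {x}" "le p a" "le p c"
    using le_total[OF pts(1,3)] pts unfolding le_def by blast
  obtain q where q: "q \<in> X - {x}" "le b q" "le d q"
    using le_total[OF pts(2,4)] pts unfolding le_def by blast
  have lepq: "le p q" using p q leab le_trans by metis
  have "x \<in> X - closed_arc R p q" using arcs[OF p(1) q(1)] lepq xX by blast
  moreover have "closed_arc R a b \<subseteq> closed_arc R p q"
  proof
    fix y assume "y \<in> closed_arc R a b"
    then have "y \<in> X - {x}" "le a y" "le y b" using mem[OF pts(1,2) leab] by blast+
    then show "y \<in> closed_arc R p q"
      using mem[OF p(1) q(1) lepq] le_trans[OF p(2)] le_trans[OF _ q(2)] by blast
  qed
  moreover have "closed_arc R c d \<subseteq> closed_arc R p q"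
  proof
    fix y assume "y \<in> closed_arc R c d"
    then have "y \<in> X - {x}" "le c y" "le y d" using mem[OF pts(3,4) lecd] by blast+
    then show "y \<in> closed_arc R p q"
      using mem[OF p(1) q(1) lepq] le_trans[OF p(3)] le_trans[OF _ q(3)] by blast
  qed
  ultimately have "x \<in> X - closed_arc R p q" and "X - closed_arc R p q \<subseteq> B \<inter> C" using ab cd by blast+
  moreover have "X - closed_arc R p q \<in> circular_base X R"
    using p q unfolding circular_base_def by blast
  ultimately show ?thesis by blast
qed

lemma openin_circular_topology:
  assumes "circular_order_on X R"
  shows "openin (circular_topology X R) U \<longleftrightarrow>
           (\<forall>x\<in>U. \<exists>B\<in>circular_base X R. x \<in> B \<and> B \<subseteq> U)"
proof
  assume "openin (circular_topology X R) U"
  then have "generate_topology_on (circular_base X R) U"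
    unfolding circular_topology_def by (rule openin_topology_generated_by)
  then show "\<forall>x\<in>U. \<exists>B\<in>circular_base X R. x \<in> B \<and> B \<subseteq> U"
  proof induction
    case (Int U V)
    show ?case
    proof
      fix x assume "x \<in> U \<inter> V"
      then obtain B C where "B \<in> circular_base X R" "C \<in> circular_base X R"
        "x \<in> B \<inter> C" "B \<subseteq> U" "C \<subseteq> V" using Int by blast
      then show "\<exists>B\<in>circular_base X R. x \<in> B \<and> B \<subseteq> U \<inter> V"
        using circular_base_Int[OF assms] by (meson Int_mono subset_trans)
    qed
  next
    case (UN \<U>)
    then show ?case by (meson UnionE Union_upper subset_trans)
  qed blast+
next
  assume "\<forall>x\<in>U. \<exists>B\<in>circular_base X R. x \<in> B \<and> B \<subseteq> U"
  then have "U = \<Union>{B \<in> circular_base X R. B \<subseteq> U}" by blast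
  moreover have "openin (circular_topology X R) (\<Union>{B \<in> circular_base X R. B \<subseteq> U})"
    unfolding circular_topology_def by (auto intro: topology_generated_by_Basis)
  ultimately show "openin (circular_topology X R) U" by simp
qed


section \<open>Automorphism groups\<close>

text \<open>Bijections of \<open>X\<close> are the elements of \<^term>\<open>Bij X\<close>, functions that are
  \<^const>\<open>undefined\<close> outside \<open>X\<close>.\<close>

definition linear_Aut :: "'a set \<Rightarrow> 'a rel \<Rightarrow> ('a \<Rightarrow> 'a) monoid" where
  "linear_Aut X r = (BijGroup X)\<lparr>carrier :=
     {g \<in> Bij X. \<forall>x\<in>X. \<forall>y\<in>X. (x, y) \<in> r \<longleftrightarrow> (g x, g y) \<in> r}\<rparr>"

definition circular_Aut :: "'a set \<Rightarrow> ('a \<times> 'a \<times> 'a) set \<Rightarrow> ('a \<Rightarrow> 'a) monoid" where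
  "circular_Aut X R = (BijGroup X)\<lparr>carrier :=
     {g \<in> Bij X. \<forall>x\<in>X. \<forall>y\<in>X. \<forall>z\<in>X. (x, y, z) \<in> R \<longleftrightarrow> (g x, g y, g z) \<in> R}\<rparr>"

definition pointwise_topology :: "'a set \<Rightarrow> ('a \<Rightarrow> 'a) set \<Rightarrow> ('a \<Rightarrow> 'a) topology" where
  "pointwise_topology X G = subtopology (product_topology (\<lambda>_. discrete_topology X) X) G"

definition linear_Homeo :: "'k set \<Rightarrow> 'k rel \<Rightarrow> ('k \<Rightarrow> 'k) monoid" where
  "linear_Homeo K r = (linear_Aut K r)\<lparr>carrier :=
     {h \<in> carrier (linear_Aut K r).
        homeomorphic_map (interval_topology K r) (interval_topology K r) h}\<rparr>"

definition circular_Homeo :: "'k set \<Rightarrow> ('k \<times> 'k \<times> 'k) set \<Rightarrow> ('k \<Rightarrow> 'k) monoid" where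
  "circular_Homeo K R = (circular_Aut K R)\<lparr>carrier :=
     {h \<in> carrier (circular_Aut K R).
        homeomorphic_map (circular_topology K R) (circular_topology K R) h}\<rparr>"

definition compact_open_topology ::
    "'k topology \<Rightarrow> 'l topology \<Rightarrow> ('k \<Rightarrow> 'l) set \<Rightarrow> ('k \<Rightarrow> 'l) topology" where
  "compact_open_topology S T H = topology_generated_by
     {{h \<in> H. h ` C \<subseteq> U} |C U. compactin S C \<and> openin T U}"


section \<open>Orderly and c-orderly topological groups\<close>

definition topological_group :: "('g, 'm) monoid_scheme \<Rightarrow> 'g topology \<Rightarrow> bool" where
  "topological_group G T \<longleftrightarrow>
     group G \<and> topspace T = carrier G \<and>
     continuous_map (prod_topology T T) T (\<lambda>(x, y). x \<otimes>\<^bsub>G\<^esub> y) \<and>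
     continuous_map T T (\<lambda>x. inv\<^bsub>G\<^esub> x)"

definition topological_group_embedding ::
    "('g, 'm) monoid_scheme \<Rightarrow> 'g topology \<Rightarrow> ('h, 'n) monoid_scheme \<Rightarrow> 'h topology \<Rightarrow>
     ('g \<Rightarrow> 'h) \<Rightarrow> bool" where
  "topological_group_embedding G S H T f \<longleftrightarrow> f \<in> hom G H \<and> embedding_map S T f"

text \<open>HOL cannot quantify existentially over types, so the type \<open>'k\<close> from which the
  points of the compact ordered space \<open>K\<close> are drawn is a parameter. A group is orderly
  (c-orderly) iff it satisfies the predicate for some \<open>'k\<close>.\<close>

definition orderly :: "'k itself \<Rightarrow> ('g, 'm) monoid_scheme \<Rightarrow> 'g topology \<Rightarrow> bool" where
  "orderly _ G T \<longleftrightarrow> topological_group G T \<and>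
     (\<exists>(K :: 'k set) r f. compact_linearly_ordered_space K r \<and>
        topological_group_embedding G T (linear_Homeo K r)
          (compact_open_topology (interval_topology K r) (interval_topology K r)
             (carrier (linear_Homeo K r))) f)"

definition c_orderly :: "'k itself \<Rightarrow> ('g, 'm) monoid_scheme \<Rightarrow> 'g topology \<Rightarrow> bool" where
  "c_orderly _ G T \<longleftrightarrow> topological_group G T \<and>
     (\<exists>(K :: 'k set) R f. compact_circularly_ordered_space K R \<and>
        topological_group_embedding G T (circular_Homeo K R)
          (compact_open_topology (circular_topology K R) (circular_topology K R)
             (carrier (circular_Homeo K R))) f)"

end

theory Submission
  imports Defs
begin

text \<open>The compact space is the space \<open>K\<close> of cuts of \<open>X\<close>: the down-sets of a linear order, ordered
  by inclusion, or the linear orders obtained by cutting a circular order open at a gap, ordered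
  circularly like the gaps. Every point \<open>x\<close> separates two neighbouring cuts, so the order topology
  of \<open>K\<close> is generated by clopen sets that involve only finitely many points of \<open>X\<close>. Hence it is
  the topology induced from a Cantor cube, in which \<open>K\<close> is closed and therefore compact. By
  compactness, all automorphisms that agree with \<open>g\<close> on some finite set lie in a given
  compact-open neighbourhood of \<open>g\<close>; conversely, mapping a suitable clopen set and its complement
  into prescribed ones determines the image of \<open>x\<close>.\<close>

section \<open>Topologies on sets of sets\<close>

text \<open>Stabilizers of points are open in the pointwise topology, and an ordinary order
  completion of \<open>X\<close> cannot see this: on the completion of the rationals, an
  automorphism uniformly close to the identity may move every rational. Turning each point into a
  jump between two cuts cures the defect, since an automorphism close to \<open>g\<close> must carry
  the jump exactly where \<open>g\<close> does. On a circle, an initial segment describes a gap only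
  relative to a chosen base gap, which automorphisms would move. Encoding a gap as the whole linear
  order that it induces, a set of pairs, avoids any choice. In both cases a cut becomes a subset of
  a set \<open>P\<close> (\<open>X\<close> or \<open>X \<times> X\<close>) on which \<open>G\<close>
  acts, the image of each point of \<open>P\<close> depending on finitely many values of the group
  element. This is all that the topological argument uses, so it is carried out once, in
  \<open>point_action\<close>.\<close>

lemma topology_generated_by_eqI:
  assumes "\<And>U. U \<in> \<A> \<Longrightarrow> openin (topology_generated_by \<B>) U"
    and "\<And>U. U \<in> \<B> \<Longrightarrow> openin (topology_generated_by \<A>) U"
  shows "topology_generated_by \<A> = topology_generated_by \<B>"
proof -
  have "openin (topology_generated_by \<D>) U"
    if "\<And>U. U \<in> \<C> \<Longrightarrow> openin (topology_generated_by \<D>) U"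
      and "openin (topology_generated_by \<C>) U" for \<C> \<D> :: "'a set set" and U
    using generate_topology_on_coarsest[OF istopology_openin that(1)
        openin_topology_generated_by[OF that(2)]] .
  then show ?thesis
    unfolding topology_eq using assms by blast
qed

text \<open>The topology induced from the Cantor cube of all subsets of \<open>'p\<close>.\<close>

definition cut_topology :: "'p set set \<Rightarrow> 'p set topology" where
  "cut_topology K = topology_generated_by {U. \<exists>p. U = {L \<in> K. p \<in> L} \<or> U = {L \<in> K. p \<notin> L}}"

lemma openin_cut_topology_mem:
  "openin (cut_topology K) {L \<in> K. p \<in> L}" "openin (cut_topology K) {L \<in> K. p \<notin> L}"
  unfolding cut_topology_def by (rule topology_generated_by_Basis, blast)+

lemma topspace_cut_topology [simp]: "topspace (cut_topology K) = K"
  unfolding cut_topology_def topology_generated_by_topspace by blast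

lemma openin_cut_topology_agree:
  assumes "finite E"
  shows "openin (cut_topology K) {M \<in> K. M \<inter> E = L \<inter> E}"
  using assms
proof induction
  case empty
  show ?case using openin_topspace[of "cut_topology K"] by simp
next
  case (insert e E)
  have "{M \<in> K. M \<inter> insert e E = L \<inter> insert e E} =
      {M \<in> K. M \<inter> E = L \<inter> E} \<inter> (if e \<in> L then {M \<in> K. e \<in> M} else {M \<in> K. e \<notin> M})"
    using insert(2) by (auto split: if_splits)
  moreover have "openin (cut_topology K) (if e \<in> L then {M \<in> K. e \<in> M} else {M \<in> K. e \<notin> M})"
    using openin_cut_topology_mem by (cases "e \<in> L") simp_all
  ultimately show ?case using openin_Int[OF insert(3)] by (simp only:)
qed

text \<open>Membership in a generator depends on one point, and finite intersections merely unite
  the finite supports. With \<open>openin_cut_topology_agree\<close>, the cuts agreeing with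
  \<open>L\<close> on a finite set form a neighbourhood base at \<open>L\<close>.\<close>

lemma openin_cut_topologyD:
  assumes "openin (cut_topology K) U" "L \<in> U"
  shows "\<exists>E. finite E \<and> (\<forall>M\<in>K. M \<inter> E = L \<inter> E \<longrightarrow> M \<in> U)"
proof -
  have "generate_topology_on {U. \<exists>p. U = {L \<in> K. p \<in> L} \<or> U = {L \<in> K. p \<notin> L}} U"
    using assms(1) openin_topology_generated_by unfolding cut_topology_def by blast
  then show ?thesis using assms(2)
  proof induction
    case (Int U V)
    then obtain E F where *: "finite E" "\<forall>M\<in>K. M \<inter> E = L \<inter> E \<longrightarrow> M \<in> U"
      "finite F" "\<forall>M\<in>K. M \<inter> F = L \<inter> F \<longrightarrow> M \<in> V" by blast
    then have "finite (E \<union> F) \<and> (\<forall>M\<in>K. M \<inter> (E \<union> F) = L \<inter> (E \<union> F) \<longrightarrow> M \<in> U \<inter> V)"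
    proof (intro conjI ballI impI IntI)
      fix M assume M: "M \<in> K" "M \<inter> (E \<union> F) = L \<inter> (E \<union> F)"
      have "M \<inter> E = L \<inter> E" "M \<inter> F = L \<inter> F" using M(2) by auto
      then show "M \<in> U" "M \<in> V" using *(2,4) M(1) by blast+
    qed (use *(1,3) in simp)
    then show ?case by (rule exI)
  next
    case (Basis U)
    then obtain p where "U = {L \<in> K. p \<in> L} \<or> U = {L \<in> K. p \<notin> L}" by blast
    then have "finite {p} \<and> (\<forall>M\<in>K. M \<inter> {p} = L \<inter> {p} \<longrightarrow> M \<in> U)"
      using Basis by auto
    then show ?case by (rule exI)
  next
    case (UN \<U>)
    from UN(3) obtain V where V: "V \<in> \<U>" "L \<in> V" by (rule UnionE)
    obtain E where "finite E" "\<And>M. M \<in> K \<Longrightarrow> M \<inter> E = L \<inter> E \<Longrightarrow> M \<in> V"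
      using UN(2)[OF V] by (elim exE conjE) simp
    then show ?case using V(1) by (intro exI[of _ E]) auto
  qed simp
qed

text \<open>The hypothesis says that not belonging to \<open>K\<close> is visible on a finite set,
  that is, the complement of \<open>K\<close> is open in the cube. It holds whenever
  \<open>K\<close> is defined by axioms each instance of which mentions finitely many
  points.\<close>

lemma compact_space_cut_topology:
  assumes closed: "\<And>L. L \<notin> K \<Longrightarrow> \<exists>F. finite F \<and> (\<forall>M. M \<inter> F = L \<inter> F \<longrightarrow> M \<notin> K)"
  shows "compact_space (cut_topology (K :: 'p set set))"
proof -
  let ?T = "product_topology (\<lambda>_ :: 'p. discrete_topology (UNIV :: bool set)) UNIV"
  let ?S = "{f. Collect f \<in> K}"
  have "openin ?T (- ?S)"
    unfolding openin_product_topology_alt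
  proof
    fix f assume "f \<in> - ?S"
    then have "Collect f \<notin> K" by simp
    from closed[OF this] obtain F
      where F: "finite F" "\<And>M. M \<inter> F = Collect f \<inter> F \<Longrightarrow> M \<notin> K"
      by (elim exE conjE) simp
    let ?U = "\<lambda>p. if p \<in> F then {f p} else UNIV"
    have "finite {p \<in> UNIV. ?U p \<noteq> topspace (discrete_topology UNIV)}"
      by (rule finite_subset[OF _ F(1)]) auto
    moreover have "Pi\<^sub>E UNIV ?U \<subseteq> - ?S"
    proof
      fix h assume "h \<in> Pi\<^sub>E UNIV ?U"
      then have "\<forall>p\<in>F. h p = f p" by (auto simp: PiE_iff split: if_splits)
      then have "Collect h \<inter> F = Collect f \<inter> F" by auto
      then show "h \<in> - ?S" using F(2) by blast
    qed
    ultimately show "\<exists>U. finite {i \<in> UNIV. U i \<noteq> topspace (discrete_topology UNIV)} \<and>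
        (\<forall>i\<in>UNIV. openin (discrete_topology UNIV) (U i)) \<and> f \<in> Pi\<^sub>E UNIV U \<and>
        Pi\<^sub>E UNIV U \<subseteq> - ?S"
      by (intro exI[of _ ?U]) auto
  qed
  then have "closedin ?T ?S"
    unfolding closedin_def by (simp add: Compl_eq_Diff_UNIV PiE_UNIV_domain)
  moreover have "compact_space ?T"
    by (simp add: compact_space_product_topology compact_space_discrete_topology)
  ultimately have "compactin ?T ?S" by (intro closedin_compact_space)
  then have S: "compactin (subtopology ?T ?S) ?S" by (simp add: compactin_subtopology)
  \<comment> \<open>\<open>Collect\<close> turns characteristic functions into sets; a continuous
    surjection is enough to carry compactness over.\<close>
  have "continuous_map (subtopology ?T ?S) (cut_topology K) Collect"
    unfolding cut_topology_def
  proof (rule continuous_on_generated_topo)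
    fix U assume "U \<in> {U. \<exists>p. U = {L \<in> K. p \<in> L} \<or> U = {L \<in> K. p \<notin> L}}"
    then obtain p b where "U = {L \<in> K. (p \<in> L) = b}" by auto
    then have "Collect -` U \<inter> topspace (subtopology ?T ?S) = ?S \<inter> {f \<in> topspace ?T. f p \<in> {b}}"
      by auto
    moreover have "openin ?T {f \<in> topspace ?T. f p \<in> {b}}"
      by (rule openin_continuous_map_preimage[OF continuous_map_product_projection]) auto
    ultimately show "openin (subtopology ?T ?S) (Collect -` U \<inter> topspace (subtopology ?T ?S))"
      by (simp add: openin_subtopology_Int2)
  qed auto
  from image_compactin[OF S this] have "compactin (cut_topology K) (Collect ` ?S)" .
  moreover have "Collect ` ?S = K"
  proof
    show "K \<subseteq> Collect ` ?S"
    proof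
      fix L assume "L \<in> K"
      then show "L \<in> Collect ` ?S" by (intro image_eqI[of _ _ "\<lambda>p. p \<in> L"]) simp_all
    qed
  qed auto
  ultimately show ?thesis by (simp add: compact_space_def)
qed

section \<open>Pointwise and compact-open topology\<close>

lemma topspace_pointwise_topology:
  "G \<subseteq> X \<rightarrow>\<^sub>E X \<Longrightarrow> topspace (pointwise_topology X G) = G"
  unfolding pointwise_topology_def by auto

text \<open>The factors are discrete, so a basic box around \<open>g\<close> shrinks to one that
  prescribes finitely many values of \<open>g\<close> and leaves all others free.\<close>

lemma openin_pointwise_topology:
  assumes G: "G \<subseteq> X \<rightarrow>\<^sub>E X"
  shows "openin (pointwise_topology X G) U \<longleftrightarrow>
    U \<subseteq> G \<and> (\<forall>g\<in>U. \<exists>F. finite F \<and> F \<subseteq> X \<and> (\<forall>h\<in>G. (\<forall>x\<in>F. h x = g x) \<longrightarrow> h \<in> U))"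
    (is "?L \<longleftrightarrow> ?R")
proof
  assume ?L
  then obtain V where V: "openin (product_topology (\<lambda>_. discrete_topology X) X) V" "U = V \<inter> G"
    unfolding pointwise_topology_def openin_subtopology by blast
  show ?R
  proof (intro conjI ballI)
    fix g assume g: "g \<in> U"
    then obtain W where W: "finite {i \<in> X. W i \<noteq> X}" "g \<in> Pi\<^sub>E X W" "Pi\<^sub>E X W \<subseteq> V"
      using V unfolding openin_product_topology_alt by auto
    have "h \<in> U" if "h \<in> G" "\<forall>x\<in>{i \<in> X. W i \<noteq> X}. h x = g x" for h
    proof -
      have "h \<in> X \<rightarrow>\<^sub>E X" using that G by blast
      have "h x \<in> W x" if "x \<in> X" for x
        using \<open>h \<in> X \<rightarrow>\<^sub>E X\<close> \<open>\<forall>x\<in>{i \<in> X. W i \<noteq> X}. h x = g x\<close> that W(2)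
        by (cases "W x = X") (auto simp: PiE_iff)
      then have "h \<in> Pi\<^sub>E X W" using \<open>h \<in> X \<rightarrow>\<^sub>E X\<close> by (auto simp: PiE_iff)
      then show ?thesis using W V that by blast
    qed
    then show "\<exists>F. finite F \<and> F \<subseteq> X \<and> (\<forall>h\<in>G. (\<forall>x\<in>F. h x = g x) \<longrightarrow> h \<in> U)"
      using W(1) by (intro exI[of _ "{i \<in> X. W i \<noteq> X}"]) blast
  qed (use V in blast)
next
  assume R: ?R
  show ?L
  proof (subst openin_subopen, intro ballI)
    fix g assume g: "g \<in> U"
    then obtain F where F: "finite F" "F \<subseteq> X" "\<forall>h\<in>G. (\<forall>x\<in>F. h x = g x) \<longrightarrow> h \<in> U"
      using R by blast
    let ?W = "Pi\<^sub>E X (\<lambda>x. if x \<in> F then {g x} else X)"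
    have gX: "g \<in> X \<rightarrow>\<^sub>E X" using g R G by blast
    have "openin (product_topology (\<lambda>_. discrete_topology X) X) ?W"
      by (rule product_topology_basis)
        (use gX F in \<open>auto intro!: finite_subset[OF _ F(1)]\<close>)
    then have "openin (pointwise_topology X G) (G \<inter> ?W)"
      unfolding pointwise_topology_def by (rule openin_subtopology_Int2)
    moreover have "g \<in> G \<inter> ?W" using g R gX by (auto simp: PiE_iff)
    moreover have "G \<inter> ?W \<subseteq> U"
    proof
      fix h assume h: "h \<in> G \<inter> ?W"
      then have "h x = g x" if "x \<in> F" for x
        using PiE_mem[of h X "\<lambda>x. if x \<in> F then {g x} else X" x] that F(2) by auto
      then show "h \<in> U" using F(3) h by blast
    qed
    ultimately show "\<exists>T. openin (pointwise_topology X G) T \<and> g \<in> T \<and> T \<subseteq> U" by blast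
  qed
qed

lemma openin_pointwise_topologyE:
  assumes "G \<subseteq> X \<rightarrow>\<^sub>E X" "openin (pointwise_topology X G) U" "g \<in> U"
  obtains F where "finite F" "F \<subseteq> X" "\<And>h. h \<in> G \<Longrightarrow> (\<And>x. x \<in> F \<Longrightarrow> h x = g x) \<Longrightarrow> h \<in> U"
proof -
  have "\<exists>F. finite F \<and> F \<subseteq> X \<and> (\<forall>h\<in>G. (\<forall>x\<in>F. h x = g x) \<longrightarrow> h \<in> U)"
    using assms(2,3) unfolding openin_pointwise_topology[OF assms(1)] by simp
  then show ?thesis by (elim exE conjE) (rule that, auto)
qed

lemma topspace_compact_open_topology:
  "topspace (compact_open_topology S T H) = H"
proof -
  \<comment> \<open>The empty compact set and the empty open set impose no condition, so
    \<open>H\<close> itself is a generator.\<close>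
  have "H = {h \<in> H. h ` {} \<subseteq> {}}" by simp
  moreover have "compactin S {} \<and> openin T {}" by simp
  ultimately show ?thesis
    unfolding compact_open_topology_def topology_generated_by_topspace by blast
qed

lemma openin_compact_open_topology:
  "compactin S C \<Longrightarrow> openin T U \<Longrightarrow> openin (compact_open_topology S T H) {h \<in> H. h ` C \<subseteq> U}"
  unfolding compact_open_topology_def
  by (rule topology_generated_by_Basis, intro CollectI, rule exI[of _ C], rule exI[of _ U]) simp

section \<open>Groups of permutations\<close>

text \<open>Once the carrier is overwritten, only the multiplication of \<open>BijGroup X\<close> is
  left; this lets both kinds of automorphism group be treated as permutation groups.\<close>

lemma linear_Aut_carrier_update [simp]:
  "(linear_Aut X r)\<lparr>carrier := G\<rparr> = (BijGroup X)\<lparr>carrier := G\<rparr>"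
  by (simp add: linear_Aut_def)

lemma circular_Aut_carrier_update [simp]:
  "(circular_Aut X R)\<lparr>carrier := G\<rparr> = (BijGroup X)\<lparr>carrier := G\<rparr>"
  by (simp add: circular_Aut_def)

lemma subgroup_BijGroupI:
  assumes "H \<subseteq> Bij X" "(\<lambda>x\<in>X. x) \<in> H"
    and "\<And>g. g \<in> H \<Longrightarrow> restrict (inv_into X g) X \<in> H"
    and "\<And>g h. g \<in> H \<Longrightarrow> h \<in> H \<Longrightarrow> compose X g h \<in> H"
  shows "subgroup H (BijGroup X)"
proof (rule group.subgroupI[OF group_BijGroup])
  show "H \<subseteq> carrier (BijGroup X)" "H \<noteq> {}" using assms(1,2) by (auto simp: BijGroup_def)
next
  fix g assume g: "g \<in> H"
  then have "g \<in> Bij X" using assms(1) by blast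
  then show "inv\<^bsub>BijGroup X\<^esub> g \<in> H" using assms(3)[OF g] by (simp add: inv_BijGroup)
next
  fix g h assume gh: "g \<in> H" "h \<in> H"
  then have "g \<in> Bij X" "h \<in> Bij X" using assms(1) by blast+
  then show "g \<otimes>\<^bsub>BijGroup X\<^esub> h \<in> H" using assms(4)[OF gh] by (simp add: BijGroup_def)
qed

lemma Bij_inv_into_right: "g \<in> Bij X \<Longrightarrow> x \<in> X \<Longrightarrow> g (inv_into X g x) = x"
  by (simp add: Bij_def bij_betw_def f_inv_into_f)

text \<open>Subgroups of \<open>linear_Aut X r\<close> thereby become subgroups of
  \<open>BijGroup X\<close>, as the locale \<open>bij_subgroup\<close> demands.\<close>

lemma subgroup_linear_Aut: "subgroup (carrier (linear_Aut X r)) (BijGroup X)"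
proof (rule subgroup_BijGroupI)
  show "carrier (linear_Aut X r) \<subseteq> Bij X" by (auto simp: linear_Aut_def)
  show "(\<lambda>x\<in>X. x) \<in> carrier (linear_Aut X r)" by (simp add: linear_Aut_def id_Bij)
next
  fix g assume "g \<in> carrier (linear_Aut X r)"
  then have g: "g \<in> Bij X" "\<forall>x\<in>X. \<forall>y\<in>X. (x, y) \<in> r \<longleftrightarrow> (g x, g y) \<in> r"
    by (simp_all add: linear_Aut_def)
  have "(x, y) \<in> r \<longleftrightarrow> (inv_into X g x, inv_into X g y) \<in> r" if "x \<in> X" "y \<in> X" for x y
    using g(2)[rule_format, of "inv_into X g x" "inv_into X g y"] that
    by (simp add: Bij_inv_into_mem[OF g(1)] Bij_inv_into_right[OF g(1)])
  then show "restrict (inv_into X g) X \<in> carrier (linear_Aut X r)"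
    using restrict_inv_into_Bij[OF g(1)] by (simp add: linear_Aut_def)
next
  fix g h assume "g \<in> carrier (linear_Aut X r)" "h \<in> carrier (linear_Aut X r)"
  then have g: "g \<in> Bij X" "\<forall>x\<in>X. \<forall>y\<in>X. (x, y) \<in> r \<longleftrightarrow> (g x, g y) \<in> r"
    and h: "h \<in> Bij X" "\<forall>x\<in>X. \<forall>y\<in>X. (x, y) \<in> r \<longleftrightarrow> (h x, h y) \<in> r"
    by (simp_all add: linear_Aut_def)
  have "(x, y) \<in> r \<longleftrightarrow> (g (h x), g (h y)) \<in> r" if "x \<in> X" "y \<in> X" for x y
    using h(2)[rule_format, OF that] g(2)[rule_format, OF funcset_mem[OF Bij_imp_funcset[OF h(1)] that(1)] funcset_mem[OF Bij_imp_funcset[OF h(1)] that(2)]] by blast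
  then show "compose X g h \<in> carrier (linear_Aut X r)"
    using compose_Bij[OF g(1) h(1)] by (simp add: linear_Aut_def compose_eq)
qed

lemma subgroup_circular_Aut: "subgroup (carrier (circular_Aut X R)) (BijGroup X)"
proof (rule subgroup_BijGroupI)
  show "carrier (circular_Aut X R) \<subseteq> Bij X" by (auto simp: circular_Aut_def)
  show "(\<lambda>x\<in>X. x) \<in> carrier (circular_Aut X R)" by (simp add: circular_Aut_def id_Bij)
next
  fix g assume "g \<in> carrier (circular_Aut X R)"
  then have g: "g \<in> Bij X"
    "\<forall>x\<in>X. \<forall>y\<in>X. \<forall>z\<in>X. (x, y, z) \<in> R \<longleftrightarrow> (g x, g y, g z) \<in> R"
    by (simp_all add: circular_Aut_def)
  have "(x, y, z) \<in> R \<longleftrightarrow> (inv_into X g x, inv_into X g y, inv_into X g z) \<in> R"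
    if "x \<in> X" "y \<in> X" "z \<in> X" for x y z
    using g(2)[rule_format, of "inv_into X g x" "inv_into X g y" "inv_into X g z"] that
    by (simp add: Bij_inv_into_mem[OF g(1)] Bij_inv_into_right[OF g(1)])
  then show "restrict (inv_into X g) X \<in> carrier (circular_Aut X R)"
    using restrict_inv_into_Bij[OF g(1)] by (simp add: circular_Aut_def)
next
  fix g h assume "g \<in> carrier (circular_Aut X R)" "h \<in> carrier (circular_Aut X R)"
  then have g: "g \<in> Bij X" "\<forall>x\<in>X. \<forall>y\<in>X. \<forall>z\<in>X. (x, y, z) \<in> R \<longleftrightarrow> (g x, g y, g z) \<in> R"
    and h: "h \<in> Bij X" "\<forall>x\<in>X. \<forall>y\<in>X. \<forall>z\<in>X. (x, y, z) \<in> R \<longleftrightarrow> (h x, h y, h z) \<in> R"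
    by (simp_all add: circular_Aut_def)
  have "(x, y, z) \<in> R \<longleftrightarrow> (g (h x), g (h y), g (h z)) \<in> R" if "x \<in> X" "y \<in> X" "z \<in> X" for x y z
    using h(2)[rule_format, OF that] g(2)[rule_format, OF funcset_mem[OF Bij_imp_funcset[OF h(1)] that(1)] funcset_mem[OF Bij_imp_funcset[OF h(1)] that(2)] funcset_mem[OF Bij_imp_funcset[OF h(1)] that(3)]] by blast
  then show "compose X g h \<in> carrier (circular_Aut X R)"
    using compose_Bij[OF g(1) h(1)] by (simp add: circular_Aut_def compose_eq)
qed

locale bij_subgroup =
  fixes X :: "'x set" and G :: "('x \<Rightarrow> 'x) set"
  assumes subgroup: "subgroup G (BijGroup X)"
begin

abbreviation perm_inv :: "('x \<Rightarrow> 'x) \<Rightarrow> 'x \<Rightarrow> 'x" where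
  "perm_inv g \<equiv> restrict (inv_into X g) X"

lemma Bij: "g \<in> G \<Longrightarrow> g \<in> Bij X"
  using subgroup.subset[OF subgroup] by (auto simp: BijGroup_def)

lemma PiE: "G \<subseteq> X \<rightarrow>\<^sub>E X"
  using Bij Bij_imp_funcset Bij_imp_extensional unfolding PiE_def by blast

lemma mem: "g \<in> G \<Longrightarrow> x \<in> X \<Longrightarrow> g x \<in> X"
  using PiE by auto

lemma inj: "g \<in> G \<Longrightarrow> x \<in> X \<Longrightarrow> y \<in> X \<Longrightarrow> g x = g y \<longleftrightarrow> x = y"
  using Bij by (auto simp: Bij_def bij_betw_def inj_on_def)

lemma surj: "g \<in> G \<Longrightarrow> g ` X = X"
  using Bij by (auto simp: Bij_def bij_betw_def)

lemma compose_mem: "g \<in> G \<Longrightarrow> h \<in> G \<Longrightarrow> compose X g h \<in> G"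
  using subgroup.m_closed[OF subgroup, of g h] Bij[of g] Bij[of h] by (simp add: BijGroup_def)

lemma inv_eq: "g \<in> G \<Longrightarrow> inv\<^bsub>(BijGroup X)\<lparr>carrier := G\<rparr>\<^esub> g = perm_inv g"
  using group.m_inv_consistent[OF group_BijGroup subgroup] inv_BijGroup[OF Bij] by metis

lemma inv_mem: "g \<in> G \<Longrightarrow> perm_inv g \<in> G"
  using subgroup.m_inv_closed[OF subgroup] inv_BijGroup[OF Bij] by metis

lemma inv_left: "g \<in> G \<Longrightarrow> x \<in> X \<Longrightarrow> perm_inv g (g x) = x"
  using mem Bij by (simp add: Bij_def bij_betw_def)

lemma inv_right: "g \<in> G \<Longrightarrow> x \<in> X \<Longrightarrow> g (perm_inv g x) = x"
  by (simp add: surj f_inv_into_f)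

lemma compose_inv_left: "g \<in> G \<Longrightarrow> compose X (perm_inv g) g = (\<lambda>x\<in>X. x)"
  using inv_left by (auto simp: compose_def fun_eq_iff restrict_def)

lemma compose_inv_right: "g \<in> G \<Longrightarrow> compose X g (perm_inv g) = (\<lambda>x\<in>X. x)"
  using inv_right by (auto simp: compose_def fun_eq_iff restrict_def)

lemma topological_group: "topological_group ((BijGroup X)\<lparr>carrier := G\<rparr>) (pointwise_topology X G)"
proof -
  let ?T = "pointwise_topology X G"
  note op = openin_pointwise_topology[OF PiE]
  have top: "topspace ?T = G" by (rule topspace_pointwise_topology[OF PiE])
  have agree: "openin ?T {h \<in> G. \<forall>x\<in>F. h x = g x}" if "finite F" "F \<subseteq> X" for F g
    unfolding op using that by (auto intro!: exI[of _ F])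
  have "continuous_map (prod_topology ?T ?T) ?T (\<lambda>(g, h). compose X g h)"
    unfolding continuous_map_def
  proof (intro conjI allI impI)
    show "(\<lambda>(g, h). compose X g h) \<in> topspace (prod_topology ?T ?T) \<rightarrow> topspace ?T"
      using compose_mem by (auto simp: top)
  next
    fix U assume U: "openin ?T U"
    show "openin (prod_topology ?T ?T)
        {z \<in> topspace (prod_topology ?T ?T). (\<lambda>(g, h). compose X g h) z \<in> U}"
      unfolding openin_prod_topology_alt
    proof (intro allI impI)
      fix g h
      assume "(g, h) \<in> {z \<in> topspace (prod_topology ?T ?T). (\<lambda>(g, h). compose X g h) z \<in> U}"
      then have gh: "g \<in> G" "h \<in> G" "compose X g h \<in> U" by (auto simp: top)
      then obtain F where F: "finite F" "F \<subseteq> X"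
        "\<And>k. k \<in> G \<Longrightarrow> (\<And>x. x \<in> F \<Longrightarrow> k x = compose X g h x) \<Longrightarrow> k \<in> U"
        using openin_pointwise_topologyE[OF PiE U] by metis
      \<comment> \<open>If \<open>h'\<close> agrees with \<open>h\<close> on \<open>F\<close>, the
        values of \<open>g' h'\<close> on \<open>F\<close> are those of \<open>g'\<close> on the
        image of \<open>F\<close> under \<open>h\<close>.\<close>
      let ?A = "{g' \<in> G. \<forall>x\<in>h ` F. g' x = g x}" and ?B = "{h' \<in> G. \<forall>x\<in>F. h' x = h x}"
      have "openin ?T ?A" "openin ?T ?B"
        using F mem[OF gh(2)] by (intro agree; blast)+
      moreover have "?A \<times> ?B \<subseteq> {z \<in> topspace (prod_topology ?T ?T). (\<lambda>(g, h). compose X g h) z \<in> U}"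
        using F by (auto simp: top compose_def compose_mem[unfolded compose_def] subset_iff intro!: F(3))
      ultimately show "\<exists>V W. openin ?T V \<and> openin ?T W \<and> g \<in> V \<and> h \<in> W \<and>
          V \<times> W \<subseteq> {z \<in> topspace (prod_topology ?T ?T). (\<lambda>(g, h). compose X g h) z \<in> U}"
        using gh by (intro exI[of _ ?A] exI[of _ ?B]) auto
    qed
  qed
  then have mult: "continuous_map (prod_topology ?T ?T) ?T
      (\<lambda>(g, h). g \<otimes>\<^bsub>(BijGroup X)\<lparr>carrier := G\<rparr>\<^esub> h)"
    by (rule continuous_map_eq) (auto simp: top BijGroup_def Bij)
  have "continuous_map ?T ?T perm_inv"
    unfolding continuous_map_def
  proof (intro conjI allI impI)
    show "perm_inv \<in> topspace ?T \<rightarrow> topspace ?T" using inv_mem by (auto simp: top)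
  next
    fix U assume U: "openin ?T U"
    show "openin ?T {g \<in> topspace ?T. perm_inv g \<in> U}"
      unfolding op
    proof (intro conjI ballI)
      fix g assume "g \<in> {g \<in> topspace ?T. perm_inv g \<in> U}"
      then have g: "g \<in> G" "perm_inv g \<in> U" by (auto simp: top)
      then obtain F where F: "finite F" "F \<subseteq> X"
        "\<And>k. k \<in> G \<Longrightarrow> (\<And>x. x \<in> F \<Longrightarrow> k x = perm_inv g x) \<Longrightarrow> k \<in> U"
        using openin_pointwise_topologyE[OF PiE U] by metis
      have FX: "perm_inv g ` F \<subseteq> X" using F(2) mem[OF inv_mem[OF g(1)]] by blast
      \<comment> \<open>An \<open>h\<close> that agrees with \<open>g\<close> at the preimage of
        \<open>x\<close> under \<open>g\<close> sends it to \<open>x\<close> as well, so both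
        inverses take the same value at \<open>x\<close>.\<close>
      have "perm_inv h \<in> U" if h: "h \<in> G" "\<forall>x\<in>perm_inv g ` F. h x = g x" for h
      proof (rule F(3)[OF inv_mem[OF h(1)]])
        fix x assume x: "x \<in> F"
        have "h (perm_inv g x) = x" using h(2) x F(2) inv_right[OF g(1)] by fastforce
        then show "perm_inv h x = perm_inv g x"
          using inv_left[OF h(1), of "perm_inv g x"] x FX by force
      qed
      then show "\<exists>F. finite F \<and> F \<subseteq> X \<and>
          (\<forall>h\<in>G. (\<forall>x\<in>F. h x = g x) \<longrightarrow> h \<in> {g \<in> topspace ?T. perm_inv g \<in> U})"
        using F(1) FX by (intro exI[of _ "perm_inv g ` F"]) (auto simp: top)
    qed (auto simp: top)
  qed
  then have "continuous_map ?T ?T (\<lambda>g. inv\<^bsub>(BijGroup X)\<lparr>carrier := G\<rparr>\<^esub> g)"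
    by (rule continuous_map_eq) (simp add: top inv_eq)
  with mult show ?thesis
    unfolding topological_group_def
    using group.subgroup_imp_group[OF group_BijGroup subgroup] by (simp add: top)
qed

end

section \<open>Actions on compact sets of subsets\<close>

text \<open>Instantiated with \<open>P = X\<close> and \<open>\<alpha> g = g\<close> for linear
  orders, and with \<open>P = X \<times> X\<close> and \<open>\<alpha> g = map_prod g g\<close> for
  circular ones. The premise in \<open>separating\<close> says that \<open>p\<close> and its image
  under the inverse of \<open>g\<close> composed with \<open>h\<close> lie in the same members of
  \<open>K\<close>; this is what the compact-open topology can detect.\<close>

locale point_action = bij_subgroup X G for X :: "'x set" and G +
  fixes P :: "'p set" and \<alpha> :: "('x \<Rightarrow> 'x) \<Rightarrow> 'p \<Rightarrow> 'p" and K :: "'p set set"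
  assumes compose: "\<And>g h p. g \<in> G \<Longrightarrow> h \<in> G \<Longrightarrow> p \<in> P \<Longrightarrow> \<alpha> (compose X g h) p = \<alpha> g (\<alpha> h p)"
    and identity: "\<And>p. p \<in> P \<Longrightarrow> \<alpha> (\<lambda>x\<in>X. x) p = p"
    and closed: "\<And>g p. g \<in> G \<Longrightarrow> p \<in> P \<Longrightarrow> \<alpha> g p \<in> P"
    and finitely_determined: "\<And>p. p \<in> P \<Longrightarrow> \<exists>F. finite F \<and> F \<subseteq> X \<and>
      (\<forall>g\<in>G. \<forall>h\<in>G. (\<forall>x\<in>F. g x = h x) \<longrightarrow> \<alpha> g p = \<alpha> h p)"
    and K_subset: "\<And>L. L \<in> K \<Longrightarrow> L \<subseteq> P"
    and K_invariant: "\<And>g L. g \<in> G \<Longrightarrow> L \<in> K \<Longrightarrow> \<alpha> g ` L \<in> K"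
    and compact: "compact_space (cut_topology K)"
    and separating: "\<And>x. x \<in> X \<Longrightarrow> \<exists>p\<in>P. \<forall>g\<in>G. \<forall>h\<in>G.
      (\<forall>L\<in>K. \<alpha> h p \<in> \<alpha> g ` L \<longleftrightarrow> p \<in> L) \<longrightarrow> g x = h x"
begin

definition act :: "('x \<Rightarrow> 'x) \<Rightarrow> 'p set \<Rightarrow> 'p set" where
  "act g = (\<lambda>L\<in>K. \<alpha> g ` L)"

section \<open>The permutation of \<open>K\<close> induced by a group element\<close>

lemma \<alpha>_inv_left: "g \<in> G \<Longrightarrow> p \<in> P \<Longrightarrow> \<alpha> (perm_inv g) (\<alpha> g p) = p"
  using compose[OF inv_mem, of g g p] identity by (simp add: compose_inv_left)

lemma \<alpha>_inv_right: "g \<in> G \<Longrightarrow> p \<in> P \<Longrightarrow> \<alpha> g (\<alpha> (perm_inv g) p) = p"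
  using compose[OF _ inv_mem, of g g p] identity by (simp add: compose_inv_right)

text \<open>On \<open>P\<close> the map \<open>\<alpha> g\<close> is undone by the action of the
  inverse of \<open>g\<close>, hence injective there; nothing is known about
  \<open>\<alpha> g\<close> outside \<open>P\<close>.\<close>

lemma mem_image:
  assumes "g \<in> G" "L \<in> K" "p \<in> P"
  shows "\<alpha> g p \<in> \<alpha> g ` L \<longleftrightarrow> p \<in> L"
proof
  assume "\<alpha> g p \<in> \<alpha> g ` L"
  then obtain q where q: "q \<in> L" "\<alpha> g p = \<alpha> g q" by blast
  have "q \<in> P" using K_subset[OF assms(2)] q(1) by blast
  have "p = \<alpha> (perm_inv g) (\<alpha> g q)" using \<alpha>_inv_left[OF assms(1,3)] q(2) by simp
  then show "p \<in> L" using \<alpha>_inv_left[OF assms(1) \<open>q \<in> P\<close>] q(1) by simp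
qed blast

lemma mem_image_inv:
  assumes "g \<in> G" "L \<in> K" "p \<in> P"
  shows "p \<in> \<alpha> g ` L \<longleftrightarrow> \<alpha> (perm_inv g) p \<in> L"
  using mem_image[OF assms(1,2) closed[OF inv_mem[OF assms(1)] assms(3)]]
    \<alpha>_inv_right[OF assms(1,3)] by simp

lemma act_mem: "g \<in> G \<Longrightarrow> L \<in> K \<Longrightarrow> act g L \<in> K"
  by (simp add: act_def K_invariant)

lemma act_compose:
  assumes "g \<in> G" "h \<in> G"
  shows "act (compose X g h) = compose K (act g) (act h)"
proof
  fix L
  show "act (compose X g h) L = compose K (act g) (act h) L"
  proof (cases "L \<in> K")
    case True
    have "\<alpha> (compose X g h) ` L = (\<lambda>p. \<alpha> g (\<alpha> h p)) ` L"
      using K_subset[OF True] compose[OF assms] by (intro image_cong) auto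
    then show ?thesis
      using True K_invariant[OF assms(2) True] by (simp add: act_def compose_def image_image)
  qed (simp add: act_def compose_def)
qed

lemma act_identity: "act (\<lambda>x\<in>X. x) = (\<lambda>L\<in>K. L)"
proof
  fix L
  have "\<alpha> (\<lambda>x\<in>X. x) ` L = L" if "L \<in> K"
    using image_cong[OF refl, of L "\<alpha> (\<lambda>x\<in>X. x)" id] identity K_subset[OF that]
    by (simp add: subset_iff)
  then show "act (\<lambda>x\<in>X. x) L = (\<lambda>L\<in>K. L) L" by (simp add: act_def)
qed

lemma act_inv_left: "g \<in> G \<Longrightarrow> L \<in> K \<Longrightarrow> act (perm_inv g) (act g L) = L"
  using fun_cong[OF act_compose[OF inv_mem, of g g], of L] act_identity
  by (simp add: compose_inv_left) (simp add: compose_def)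

lemma act_inv_right: "g \<in> G \<Longrightarrow> L \<in> K \<Longrightarrow> act g (act (perm_inv g) L) = L"
  using fun_cong[OF act_compose[OF _ inv_mem, of g g], of L] act_identity
  by (simp add: compose_inv_right) (simp add: compose_def)

lemma act_Bij:
  assumes "g \<in> G"
  shows "act g \<in> Bij K"
proof -
  have "bij_betw (act g) K K"
    by (rule bij_betw_byWitness[of _ "act (perm_inv g)"])
      (use assms act_inv_left act_inv_right act_mem inv_mem in auto)
  then show ?thesis by (simp add: Bij_def act_def)
qed

lemma continuous_map_act:
  assumes g: "g \<in> G"
  shows "continuous_map (cut_topology K) (cut_topology K) (act g)"
proof -
  have "openin (cut_topology K) (act g -` U \<inter> K)"
    if "U \<in> {U. \<exists>p. U = {L \<in> K. p \<in> L} \<or> U = {L \<in> K. p \<notin> L}}" for U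
  proof -
    from that obtain p b where U: "U = {L \<in> K. (p \<in> L) = b}" by auto
    have "act g -` U \<inter> K = {L \<in> K. (p \<in> \<alpha> g ` L) = b}"
      using act_mem[OF g] by (auto simp: U act_def)
    also have "openin (cut_topology K) \<dots>"
    proof (cases "p \<in> P")
      case True
      have "{L \<in> K. (p \<in> \<alpha> g ` L) = b} = {L \<in> K. (\<alpha> (perm_inv g) p \<in> L) = b}"
        using mem_image_inv[OF g _ True] by auto
      then show ?thesis using openin_cut_topology_mem by (cases b) simp_all
    next
      case False
      \<comment> \<open>Members of \<open>K\<close> lie in \<open>P\<close>, so a point outside
        \<open>P\<close> gives only the trivial preimages.\<close>
      then have "p \<notin> \<alpha> g ` L" if "L \<in> K" for L
        using K_subset[OF K_invariant[OF g that]] by blast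
      then have "{L \<in> K. (p \<in> \<alpha> g ` L) = b} = (if b then {} else K)"
        by auto
      then show ?thesis using openin_topspace[of "cut_topology K"] by simp
    qed
    finally show ?thesis .
  qed
  then have "continuous_map (cut_topology K)
      (topology_generated_by {U. \<exists>p. U = {L \<in> K. p \<in> L} \<or> U = {L \<in> K. p \<notin> L}}) (act g)"
    using act_mem[OF g] topspace_cut_topology[of K, unfolded cut_topology_def topology_generated_by_topspace]
    by (intro continuous_on_generated_topo) (simp_all add: image_subset_iff del: mem_Collect_eq Union_iff)
  then show ?thesis by (simp add: cut_topology_def)
qed

lemma homeomorphic_map_act:
  assumes "g \<in> G"
  shows "homeomorphic_map (cut_topology K) (cut_topology K) (act g)"
proof -
  have "homeomorphic_maps (cut_topology K) (cut_topology K) (act g) (act (perm_inv g))"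
    unfolding homeomorphic_maps_def
    using assms by (simp add: continuous_map_act inv_mem act_inv_left act_inv_right)
  then show ?thesis by (simp add: homeomorphic_maps_map)
qed

text \<open>A set \<open>U\<close> that is open around \<open>\<alpha> g ` L\<close> depends there only on finitely many points, and
  these are the images of finitely many points on which \<open>g\<close> and \<open>h\<close> act alike.\<close>

lemma act_stays_in_open:
  assumes g: "g \<in> G" and U: "openin (cut_topology K) U" and L: "L \<in> K" "\<alpha> g ` L \<in> U"
  obtains W F where "openin (cut_topology K) W" "L \<in> W" "finite F" "F \<subseteq> X"
    "\<And>h M. h \<in> G \<Longrightarrow> (\<And>x. x \<in> F \<Longrightarrow> h x = g x) \<Longrightarrow> M \<in> W \<Longrightarrow> \<alpha> h ` M \<in> U"
proof -
  from openin_cut_topologyD[OF U L(2)] obtain E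
    where E: "finite E" "\<And>M. M \<in> K \<Longrightarrow> M \<inter> E = \<alpha> g ` L \<inter> E \<Longrightarrow> M \<in> U" by (elim exE conjE) simp
  define E' where "E' = \<alpha> (perm_inv g) ` (E \<inter> P)"
  have E': "finite E'" "E' \<subseteq> P" using E(1) closed[OF inv_mem[OF g]] by (auto simp: E'_def)
  then have "\<forall>p\<in>E'. \<exists>F. finite F \<and> F \<subseteq> X \<and>
      (\<forall>g\<in>G. \<forall>h\<in>G. (\<forall>x\<in>F. g x = h x) \<longrightarrow> \<alpha> g p = \<alpha> h p)"
    using finitely_determined by (intro ballI) (simp add: subset_iff)
  from bchoice[OF this] obtain F where F: "\<And>p. p \<in> E' \<Longrightarrow> finite (F p)" "\<And>p. p \<in> E' \<Longrightarrow> F p \<subseteq> X"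
    "\<And>p g h. p \<in> E' \<Longrightarrow> g \<in> G \<Longrightarrow> h \<in> G \<Longrightarrow> (\<And>x. x \<in> F p \<Longrightarrow> g x = h x) \<Longrightarrow> \<alpha> g p = \<alpha> h p"
    by metis
  show ?thesis
  proof (rule that)
    show "openin (cut_topology K) {M \<in> K. M \<inter> E' = L \<inter> E'}"
      by (rule openin_cut_topology_agree[OF E'(1)])
    show "L \<in> {M \<in> K. M \<inter> E' = L \<inter> E'}" using L(1) by simp
    show "finite (\<Union>p\<in>E'. F p)" using E'(1) F(1) by simp
    show "(\<Union>p\<in>E'. F p) \<subseteq> X" using F(2) by (rule UN_least)
  next
    fix h M
    assume h: "h \<in> G" "\<And>x. x \<in> (\<Union>p\<in>E'. F p) \<Longrightarrow> h x = g x" and "M \<in> {M \<in> K. M \<inter> E' = L \<inter> E'}"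
    then have M: "M \<in> K" "M \<inter> E' = L \<inter> E'" by simp_all
    show "\<alpha> h ` M \<in> U"
    proof (rule E(2)[OF K_invariant[OF h(1) M(1)]])
      have "e \<in> \<alpha> h ` M \<longleftrightarrow> e \<in> \<alpha> g ` L" if e: "e \<in> E" "e \<in> P" for e
      proof -
        define q where "q = \<alpha> (perm_inv g) e"
        have q: "q \<in> E'" "q \<in> P" using e E'(2) by (auto simp: E'_def q_def)
        have "\<alpha> g q = e" using \<alpha>_inv_right[OF g e(2)] by (simp add: q_def)
        moreover have "\<alpha> h q = \<alpha> g q" using F(3)[OF q(1) h(1) g] h(2) q(1) by blast
        moreover have "q \<in> M \<longleftrightarrow> q \<in> L" using M(2) q(1) by blast
        ultimately show ?thesis
          using mem_image[OF h(1) M(1) q(2)] mem_image[OF g L(1) q(2)] by simp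
      qed
      moreover have "\<alpha> h ` M \<subseteq> P" "\<alpha> g ` L \<subseteq> P"
        using K_subset K_invariant h(1) M(1) g L(1) by blast+
      ultimately show "\<alpha> h ` M \<inter> E = \<alpha> g ` L \<inter> E" by blast
    qed
  qed
qed

text \<open>\<open>act_stays_in_open\<close> is joint continuity of the action at \<open>g\<close>
  and \<open>L\<close>. The tube argument makes it uniform over the compact set \<open>C\<close>:
  finitely many \<open>W L\<close> cover \<open>C\<close>, and the union of their finite sets
  \<open>F L\<close> controls all of \<open>C\<close> at once.\<close>

lemma continuous_map_act_compact_open:
  assumes H: "act ` G \<subseteq> H"
  shows "continuous_map (pointwise_topology X G)
    (compact_open_topology (cut_topology K) (cut_topology K) H) act"
proof -
  let ?T = "cut_topology K"
  note top = topspace_pointwise_topology[OF PiE]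
  let ?B = "{{h \<in> H. h ` C \<subseteq> U} |C U. compactin ?T C \<and> openin ?T U}"
  have "openin (pointwise_topology X G) (act -` V \<inter> G)" if "V \<in> ?B" for V
  proof -
    from that obtain C U where CU: "compactin ?T C" "openin ?T U" "V = {h \<in> H. h ` C \<subseteq> U}"
      by (elim CollectE exE conjE) simp
    have CK: "C \<subseteq> K" using compactin_subset_topspace[OF CU(1)] by simp
    show ?thesis
      unfolding openin_pointwise_topology[OF PiE]
    proof (intro conjI ballI)
      fix g assume "g \<in> act -` V \<inter> G"
      then have g: "g \<in> G" "\<And>L. L \<in> C \<Longrightarrow> \<alpha> g ` L \<in> U"
        using CK by (auto simp: CU(3) act_def)
      have "\<exists>W F. openin ?T W \<and> L \<in> W \<and> finite F \<and> F \<subseteq> X \<and>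
          (\<forall>h M. h \<in> G \<longrightarrow> (\<forall>x\<in>F. h x = g x) \<longrightarrow> M \<in> W \<longrightarrow> \<alpha> h ` M \<in> U)" if L: "L \<in> C" for L
      proof -
        have "L \<in> K" using L CK by blast
        from act_stays_in_open[OF g(1) CU(2) this g(2)[OF L]] show ?thesis by metis
      qed
      then have "\<forall>L\<in>C. \<exists>W F. openin ?T W \<and> L \<in> W \<and> finite F \<and> F \<subseteq> X \<and>
          (\<forall>h M. h \<in> G \<longrightarrow> (\<forall>x\<in>F. h x = g x) \<longrightarrow> M \<in> W \<longrightarrow> \<alpha> h ` M \<in> U)" by (rule ballI)
      from bchoice[OF this] obtain W where "\<forall>L\<in>C. \<exists>F. openin ?T (W L) \<and> L \<in> W L \<and> finite F \<and> F \<subseteq> X \<and>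
          (\<forall>h M. h \<in> G \<longrightarrow> (\<forall>x\<in>F. h x = g x) \<longrightarrow> M \<in> W L \<longrightarrow> \<alpha> h ` M \<in> U)" ..
      from bchoice[OF this] obtain F where "\<forall>L\<in>C. openin ?T (W L) \<and> L \<in> W L \<and> finite (F L) \<and> F L \<subseteq> X \<and>
          (\<forall>h M. h \<in> G \<longrightarrow> (\<forall>x\<in>F L. h x = g x) \<longrightarrow> M \<in> W L \<longrightarrow> \<alpha> h ` M \<in> U)" ..
      then have WF: "\<And>L. L \<in> C \<Longrightarrow> openin ?T (W L)" "\<And>L. L \<in> C \<Longrightarrow> L \<in> W L"
        "\<And>L. L \<in> C \<Longrightarrow> finite (F L)" "\<And>L. L \<in> C \<Longrightarrow> F L \<subseteq> X"
        "\<And>L h M. L \<in> C \<Longrightarrow> h \<in> G \<Longrightarrow> (\<And>x. x \<in> F L \<Longrightarrow> h x = g x) \<Longrightarrow> M \<in> W L \<Longrightarrow> \<alpha> h ` M \<in> U"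
        by simp_all
      have "\<exists>\<F>. finite \<F> \<and> \<F> \<subseteq> W ` C \<and> C \<subseteq> \<Union>\<F>"
        by (rule compactinD[OF CU(1)]) (use WF(1,2) in auto)
      then obtain D where D: "finite D" "D \<subseteq> C" "C \<subseteq> \<Union>(W ` D)"
        using finite_subset_image by metis
      have "h \<in> act -` V \<inter> G" if h: "h \<in> G" "\<forall>x\<in>(\<Union>L\<in>D. F L). h x = g x" for h
      proof -
        have "act h M \<in> U" if M: "M \<in> C" for M
        proof -
          from M D(3) obtain L where L: "L \<in> D" "M \<in> W L" by blast
          have "\<alpha> h ` M \<in> U"
            by (rule WF(5)[OF _ h(1) _ L(2)]) (use L(1) D(2) h(2) in auto)
          then show ?thesis using M CK by (auto simp: act_def)
        qed
        then show ?thesis using h(1) H by (auto simp: CU(3))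
      qed
      moreover have "finite (\<Union>L\<in>D. F L)" "(\<Union>L\<in>D. F L) \<subseteq> X" using D WF(3,4) by blast+
      ultimately show "\<exists>F. finite F \<and> F \<subseteq> X \<and>
          (\<forall>h\<in>G. (\<forall>x\<in>F. h x = g x) \<longrightarrow> h \<in> act -` V \<inter> G)"
        by (intro exI[of _ "\<Union>L\<in>D. F L"]) simp
    qed simp
  qed
  moreover have "act ` G \<subseteq> \<Union>?B"
    using topspace_compact_open_topology[of ?T ?T H] H
    unfolding compact_open_topology_def topology_generated_by_topspace by simp
  ultimately show ?thesis
    unfolding compact_open_topology_def
    by (intro continuous_on_generated_topo) (simp_all add: top del: mem_Collect_eq Union_iff)
qed

text \<open>Being clopen in a compact space, these sets may serve both as the compact and as the
  open set of a compact-open generator.\<close>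

lemma compactin_mem: "compactin (cut_topology K) {L \<in> K. p \<in> L}" "compactin (cut_topology K) {L \<in> K. p \<notin> L}"
proof -
  have "K - {L \<in> K. p \<notin> L} = {L \<in> K. p \<in> L}" "K - {L \<in> K. p \<in> L} = {L \<in> K. p \<notin> L}" by blast+
  then have "closedin (cut_topology K) {L \<in> K. p \<in> L}" "closedin (cut_topology K) {L \<in> K. p \<notin> L}"
    using openin_cut_topology_mem[of K p] by (simp_all add: closedin_def)
  then show "compactin (cut_topology K) {L \<in> K. p \<in> L}" "compactin (cut_topology K) {L \<in> K. p \<notin> L}"
    using closedin_compact_space[OF compact] by blast+
qed

text \<open>This is continuity of the inverse of \<open>act\<close>, one coordinate \<open>x\<close>
  at a time. The test point \<open>p\<close> comes from \<open>separating\<close>.\<close>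

lemma act_neighbourhood:
  assumes H: "act ` G \<subseteq> H" and g: "g \<in> G" and x: "x \<in> X"
  obtains V where "openin (compact_open_topology (cut_topology K) (cut_topology K) H) V"
    "act g \<in> V" "\<And>h. h \<in> G \<Longrightarrow> act h \<in> V \<Longrightarrow> h x = g x"
proof -
  from separating[OF x] obtain p where p: "p \<in> P"
    "\<And>g h. g \<in> G \<Longrightarrow> h \<in> G \<Longrightarrow> (\<And>L. L \<in> K \<Longrightarrow> \<alpha> h p \<in> \<alpha> g ` L \<longleftrightarrow> p \<in> L) \<Longrightarrow> g x = h x"
    by metis
  let ?V = "{k \<in> H. k ` {L \<in> K. p \<in> L} \<subseteq> {L \<in> K. \<alpha> g p \<in> L}} \<inter>
    {k \<in> H. k ` {L \<in> K. p \<notin> L} \<subseteq> {L \<in> K. \<alpha> g p \<notin> L}}"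
  show ?thesis
  proof (rule that)
    show "openin (compact_open_topology (cut_topology K) (cut_topology K) H) ?V"
      by (intro openin_Int openin_compact_open_topology compactin_mem openin_cut_topology_mem)
    show "act g \<in> ?V"
      using H g act_mem[OF g] mem_image[OF g _ p(1)] by (auto simp: act_def)
  next
    fix h assume h: "h \<in> G" "act h \<in> ?V"
    \<comment> \<open>\<open>separating\<close> is applied with \<open>g\<close> and
      \<open>h\<close> exchanged. The two halves of \<open>?V\<close> supply the two directions of
      its premise.\<close>
    show "h x = g x"
    proof (rule p(2)[OF h(1) g])
      fix L assume "L \<in> K"
      moreover have "act h ` {L \<in> K. p \<in> L} \<subseteq> {L \<in> K. \<alpha> g p \<in> L}"
        "act h ` {L \<in> K. p \<notin> L} \<subseteq> {L \<in> K. \<alpha> g p \<notin> L}"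
        using h(2) by simp_all
      ultimately have "p \<in> L \<Longrightarrow> \<alpha> g p \<in> act h L" "p \<notin> L \<Longrightarrow> \<alpha> g p \<notin> act h L"
        by (simp_all add: image_subset_iff)
      then show "\<alpha> g p \<in> \<alpha> h ` L \<longleftrightarrow> p \<in> L" using \<open>L \<in> K\<close> by (auto simp: act_def)
    qed
  qed
qed

text \<open>An open \<open>U\<close> around \<open>g\<close> is controlled by a finite set
  \<open>F\<close>; intersecting the neighbourhoods of \<open>act g\<close> that fix the value at
  each \<open>x\<close> in \<open>F\<close> gives openness onto the image. The same neighbourhoods
  give injectivity, since \<open>act g = act h\<close> lies in all of them.\<close>

lemma embedding_map_act:
  assumes H: "act ` G \<subseteq> H"
  shows "embedding_map (pointwise_topology X G)
    (compact_open_topology (cut_topology K) (cut_topology K) H) act"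
proof -
  let ?P = "pointwise_topology X G" and ?C = "compact_open_topology (cut_topology K) (cut_topology K) H"
  note top = topspace_pointwise_topology[OF PiE]
  have opn: "open_map ?P (subtopology ?C (act ` G)) act"
    unfolding open_map_def
  proof (intro allI impI)
    fix U assume U: "openin ?P U"
    then have UG: "U \<subseteq> G" using openin_subset top by metis
    show "openin (subtopology ?C (act ` G)) (act ` U)"
    proof (subst openin_subopen, intro ballI)
      fix k assume "k \<in> act ` U"
      then obtain g where g: "g \<in> U" "k = act g" by blast
      have gG: "g \<in> G" using g UG by blast
      obtain F where F: "finite F" "F \<subseteq> X" "\<And>h. h \<in> G \<Longrightarrow> (\<And>x. x \<in> F \<Longrightarrow> h x = g x) \<Longrightarrow> h \<in> U"
        using openin_pointwise_topologyE[OF PiE U g(1)] by metis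
      have "\<exists>V. openin ?C V \<and> act g \<in> V \<and> (\<forall>h\<in>G. act h \<in> V \<longrightarrow> h x = g x)" if "x \<in> F" for x
        using act_neighbourhood[OF H gG, of x] F(2) that by (metis subsetD)
      then obtain V where V: "\<And>x. x \<in> F \<Longrightarrow> openin ?C (V x)" "\<And>x. x \<in> F \<Longrightarrow> act g \<in> V x"
        "\<And>x h. x \<in> F \<Longrightarrow> h \<in> G \<Longrightarrow> act h \<in> V x \<Longrightarrow> h x = g x" by metis
      \<comment> \<open>The factor \<open>topspace ?C\<close> matters when \<open>F\<close> is empty
        and the intersection is the whole type.\<close>
      let ?V = "(\<Inter>x\<in>F. V x) \<inter> topspace ?C"
      have "openin ?C ?V" using F(1) V(1) by (intro openin_INT) auto
      then have "openin (subtopology ?C (act ` G)) (act ` G \<inter> ?V)"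
        by (rule openin_subtopology_Int2)
      moreover have "k \<in> act ` G \<inter> ?V"
        using g gG V(2) H by (auto simp: topspace_compact_open_topology)
      moreover have "act ` G \<inter> ?V \<subseteq> act ` U"
        using F(3) V(3) by blast
      ultimately show "\<exists>T. openin (subtopology ?C (act ` G)) T \<and> k \<in> T \<and> T \<subseteq> act ` U" by blast
    qed
  qed
  have inj: "inj_on act (topspace ?P)"
    unfolding top
  proof (rule inj_onI)
    fix g h assume gh: "g \<in> G" "h \<in> G" "act g = act h"
    have "g x = h x" if "x \<in> X" for x
      using act_neighbourhood[OF H gh(2) that] gh by metis
    moreover have "g \<in> extensional X" "h \<in> extensional X"
      using gh Bij Bij_imp_extensional by blast+
    ultimately show "g = h" by (intro extensionalityI)
  qed
  have cont: "continuous_map ?P (subtopology ?C (act ` G)) act"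
    using continuous_map_act_compact_open[OF H] by (simp add: continuous_map_in_subtopology top)
  have surj: "act ` topspace ?P = topspace (subtopology ?C (act ` G))"
    using H by (auto simp: top topspace_compact_open_topology)
  show ?thesis
    unfolding embedding_map_def
    using bijective_open_imp_homeomorphic_map[OF cont opn surj inj] by (simp only: top)
qed

text \<open>\<open>H\<close> stays arbitrary so that it can become the homeomorphism group of the
  linear or of the circular order on \<open>K\<close>.\<close>

lemma topological_group_embedding_act:
  assumes "act ` G \<subseteq> H" "H \<subseteq> Bij K"
  shows "topological_group_embedding ((BijGroup X)\<lparr>carrier := G\<rparr>) (pointwise_topology X G)
    ((BijGroup K)\<lparr>carrier := H\<rparr>) (compact_open_topology (cut_topology K) (cut_topology K) H) act"
proof -
  have "act \<in> hom ((BijGroup X)\<lparr>carrier := G\<rparr>) ((BijGroup K)\<lparr>carrier := H\<rparr>)"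
    using assms(1) Bij act_Bij act_compose by (auto simp: hom_def BijGroup_def)
  then show ?thesis
    unfolding topological_group_embedding_def using embedding_map_act[OF assms(1)] by simp
qed

end

section \<open>Linear orders\<close>

definition inclusion_order :: "'p set set \<Rightarrow> 'p set rel" where
  "inclusion_order K = {(D, E). D \<in> K \<and> E \<in> K \<and> D \<subseteq> E}"

definition down_sets :: "'a set \<Rightarrow> 'a rel \<Rightarrow> 'a set set" where
  "down_sets X r = {D. D \<subseteq> X \<and> (\<forall>x y. x \<in> D \<longrightarrow> (y, x) \<in> r \<longrightarrow> y \<in> D)}"

locale linear_ordered_set =
  fixes X :: "'a set" and r :: "'a rel"
  assumes linear_order: "linear_order_on X r"
begin

lemma rel_mem: "(x, y) \<in> r \<Longrightarrow> x \<in> X \<and> y \<in> X"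
  and refl: "x \<in> X \<Longrightarrow> (x, x) \<in> r"
  and trans: "(x, y) \<in> r \<Longrightarrow> (y, z) \<in> r \<Longrightarrow> (x, z) \<in> r"
  and antisym: "(x, y) \<in> r \<Longrightarrow> (y, x) \<in> r \<Longrightarrow> x = y"
  and total: "x \<in> X \<Longrightarrow> y \<in> X \<Longrightarrow> (x, y) \<in> r \<or> (y, x) \<in> r"
proof -
  have *: "r \<subseteq> X \<times> X" "\<forall>x\<in>X. (x, x) \<in> r" "Relation.trans r" "Relation.antisym r"
    "\<forall>x\<in>X. \<forall>y\<in>X. x \<noteq> y \<longrightarrow> (x, y) \<in> r \<or> (y, x) \<in> r"
    using linear_order by (simp_all add: order_on_defs refl_on_def total_on_def)
  show "(x, y) \<in> r \<Longrightarrow> x \<in> X \<and> y \<in> X" using *(1) by auto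
  show "x \<in> X \<Longrightarrow> (x, x) \<in> r" using *(2) by (rule bspec)
  show "(x, y) \<in> r \<Longrightarrow> (y, z) \<in> r \<Longrightarrow> (x, z) \<in> r" using *(3) by (rule transD)
  show "(x, y) \<in> r \<Longrightarrow> (y, x) \<in> r \<Longrightarrow> x = y" using *(4) by (rule antisymD)
  show "x \<in> X \<Longrightarrow> y \<in> X \<Longrightarrow> (x, y) \<in> r \<or> (y, x) \<in> r" using *(2,5) by (cases "x = y") simp_all
qed

abbreviation K where "K \<equiv> down_sets X r"
abbreviation \<rho> where "\<rho> \<equiv> inclusion_order K"

lemma down_setD:
  assumes "D \<in> K"
  shows "x \<in> D \<Longrightarrow> x \<in> X" "x \<in> D \<Longrightarrow> (y, x) \<in> r \<Longrightarrow> y \<in> D"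
  using assms by (auto simp: down_sets_def)

text \<open>A point of \<open>E\<close> missing from \<open>D\<close> lies above all of
  \<open>D\<close>, so \<open>E\<close> contains everything in \<open>D\<close>.\<close>

lemma down_sets_chain:
  assumes "D \<in> K" "E \<in> K" "x \<in> E" "x \<notin> D"
  shows "D \<subset> E"
proof
  show "D \<subseteq> E"
  proof
    fix y assume y: "y \<in> D"
    have "(y, x) \<in> r"
      using total[of y x] down_setD[OF assms(1)] down_setD(1)[OF assms(2,3)] y assms(4) by blast
    then show "y \<in> E" using down_setD(2)[OF assms(2,3)] by blast
  qed
qed (use assms in blast)

lemma linear_order_inclusion: "linear_order_on K \<rho>"
  unfolding order_on_defs refl_on_def total_on_def inclusion_order_def
proof (intro conjI)
  show "\<forall>D\<in>K. \<forall>E\<in>K. D \<noteq> E \<longrightarrow> (D, E) \<in> {(D, E). D \<in> K \<and> E \<in> K \<and> D \<subseteq> E} \<or>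
      (E, D) \<in> {(D, E). D \<in> K \<and> E \<in> K \<and> D \<subseteq> E}"
    using down_sets_chain by (clarsimp simp: subset_iff) (metis psubsetD)
qed (auto intro!: transI antisymI)

lemma principal_down_sets:
  assumes "x \<in> X"
  shows "{y. (y, x) \<in> r} \<in> K" "{y. (y, x) \<in> r \<and> y \<noteq> x} \<in> K"
  using rel_mem trans antisym by (auto simp: down_sets_def)

text \<open>The cuts containing \<open>p\<close> form the open ray above the cut just below
  \<open>p\<close>, and those omitting \<open>p\<close> the open ray below the cut just above
  \<open>p\<close>. In the other direction, \<open>E\<close> lies strictly above \<open>D\<close>
  iff it contains some point outside \<open>D\<close>, so rays are unions of generators.\<close>

lemma interval_topology_down_sets: "interval_topology K \<rho> = cut_topology K"
  unfolding interval_topology_def cut_topology_def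
proof (rule topology_generated_by_eqI, fold cut_topology_def interval_topology_def)
  fix U
  assume "U \<in> insert K ({{E \<in> K. (D, E) \<in> \<rho> \<and> E \<noteq> D} |D. D \<in> K} \<union>
    {{E \<in> K. (E, D) \<in> \<rho> \<and> E \<noteq> D} |D. D \<in> K})"
  then consider "U = K" | D where "D \<in> K" "U = {E \<in> K. D \<subset> E}" | D where "D \<in> K" "U = {E \<in> K. E \<subset> D}"
    by (auto simp: inclusion_order_def psubset_eq)
  then show "openin (cut_topology K) U"
  proof cases
    case 1
    then show ?thesis using openin_topspace[of "cut_topology K"] by simp
  next
    case 2
    have "U = (\<Union>x\<in>X - D. {E \<in> K. x \<in> E})"
    proof
      show "U \<subseteq> (\<Union>x\<in>X - D. {E \<in> K. x \<in> E})"
      proof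
        fix E assume "E \<in> U"
        then have E: "E \<in> K" "D \<subset> E" using 2(2) by simp_all
        then obtain x where "x \<in> E" "x \<notin> D" by (auto dest: psubset_imp_ex_mem)
        then show "E \<in> (\<Union>x\<in>X - D. {E \<in> K. x \<in> E})"
          using down_setD(1)[OF E(1)] E(1) by (intro UN_I[of x]) simp_all
      qed
      show "(\<Union>x\<in>X - D. {E \<in> K. x \<in> E}) \<subseteq> U"
      proof
        fix E assume "E \<in> (\<Union>x\<in>X - D. {E \<in> K. x \<in> E})"
        then obtain x where "E \<in> K" "x \<in> E" "x \<notin> D" by auto
        then show "E \<in> U" using 2(2) down_sets_chain[OF 2(1)] by simp
      qed
    qed
    also have "openin (cut_topology K) \<dots>"
      using openin_cut_topology_mem by (intro openin_Union ballI) (auto simp del: mem_Collect_eq)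
    finally show ?thesis .
  next
    case 3
    have "U = (\<Union>x\<in>D. {E \<in> K. x \<notin> E})"
    proof
      show "U \<subseteq> (\<Union>x\<in>D. {E \<in> K. x \<notin> E})"
      proof
        fix E assume "E \<in> U"
        then have E: "E \<in> K" "E \<subset> D" using 3(2) by simp_all
        then obtain x where "x \<in> D" "x \<notin> E" by (auto dest: psubset_imp_ex_mem)
        then show "E \<in> (\<Union>x\<in>D. {E \<in> K. x \<notin> E})" using E(1) by (intro UN_I[of x]) simp_all
      qed
      show "(\<Union>x\<in>D. {E \<in> K. x \<notin> E}) \<subseteq> U"
      proof
        fix E assume "E \<in> (\<Union>x\<in>D. {E \<in> K. x \<notin> E})"
        then obtain x where "E \<in> K" "x \<in> D" "x \<notin> E" by auto
        then show "E \<in> U" using 3(2) down_sets_chain[OF _ 3(1)] by simp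
      qed
    qed
    also have "openin (cut_topology K) \<dots>"
      using openin_cut_topology_mem by (intro openin_Union ballI) (auto simp del: mem_Collect_eq)
    finally show ?thesis .
  qed
next
  fix U
  assume "U \<in> {U. \<exists>p. U = {L \<in> K. p \<in> L} \<or> U = {L \<in> K. p \<notin> L}}"
  then obtain p where U: "U = {L \<in> K. p \<in> L} \<or> U = {L \<in> K. p \<notin> L}" by (elim CollectE exE)
  have above: "openin (interval_topology K \<rho>) {E \<in> K. D \<subset> E}" if "D \<in> K" for D
  proof -
    have "{E \<in> K. D \<subset> E} = {E \<in> K. (D, E) \<in> \<rho> \<and> E \<noteq> D}"
      using that by (auto simp: inclusion_order_def)
    then show ?thesis
      unfolding interval_topology_def
      by (intro topology_generated_by_Basis insertI2 UnI1 CollectI exI[of _ D]) (simp add: that)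
  qed
  have below: "openin (interval_topology K \<rho>) {E \<in> K. E \<subset> D}" if "D \<in> K" for D
  proof -
    have "{E \<in> K. E \<subset> D} = {E \<in> K. (E, D) \<in> \<rho> \<and> E \<noteq> D}"
      using that by (auto simp: inclusion_order_def)
    then show ?thesis
      unfolding interval_topology_def
      by (intro topology_generated_by_Basis insertI2 UnI2 CollectI exI[of _ D]) (simp add: that)
  qed
  \<comment> \<open>This uses the extra generator of \<open>interval_topology\<close>: if
    \<open>X\<close> is empty, \<open>K\<close> is a single point and its rays are empty.\<close>
  have whole: "openin (interval_topology K \<rho>) K"
    unfolding interval_topology_def by (rule topology_generated_by_Basis) (rule insertI1)
  show "openin (interval_topology K \<rho>) U"
  proof (cases "p \<in> X")
    case True
    have "(p \<in> E) = ({y. (y, p) \<in> r \<and> y \<noteq> p} \<subset> E)" if E: "E \<in> K" for E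
    proof
      show "p \<in> E \<Longrightarrow> {y. (y, p) \<in> r \<and> y \<noteq> p} \<subset> E"
        using down_setD(2)[OF E] by blast
      assume "{y. (y, p) \<in> r \<and> y \<noteq> p} \<subset> E"
      then obtain u where u: "u \<in> E" "\<not> ((u, p) \<in> r \<and> u \<noteq> p)" by blast
      then have "(p, u) \<in> r" using total[OF True, of u] down_setD(1)[OF E] refl[OF True] by blast
      then show "p \<in> E" using down_setD(2)[OF E] u(1) by blast
    qed
    moreover have "(p \<notin> E) = (E \<subset> {y. (y, p) \<in> r})" if E: "E \<in> K" for E
    proof
      show "p \<notin> E \<Longrightarrow> E \<subset> {y. (y, p) \<in> r}"
        using down_sets_chain[OF E principal_down_sets(1)[OF True], of p] refl[OF True] by simp
      assume "E \<subset> {y. (y, p) \<in> r}"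
      then obtain u where "(u, p) \<in> r" "u \<notin> E" by blast
      then show "p \<notin> E" using down_setD(2)[OF E] by blast
    qed
    ultimately have eq: "{L \<in> K. p \<in> L} = {E \<in> K. {y. (y, p) \<in> r \<and> y \<noteq> p} \<subset> E}"
      "{L \<in> K. p \<notin> L} = {E \<in> K. E \<subset> {y. (y, p) \<in> r}}" by (simp_all cong: conj_cong)
    show ?thesis
      using U
    proof
      assume "U = {L \<in> K. p \<in> L}"
      then show ?thesis using above[OF principal_down_sets(2)[OF True]] unfolding eq(1) by (simp only:)
    next
      assume "U = {L \<in> K. p \<notin> L}"
      then show ?thesis using below[OF principal_down_sets(1)[OF True]] unfolding eq(2) by (simp only:)
    qed
  next
    case False
    then have "p \<notin> L" if "L \<in> K" for L using down_setD(1)[OF that] by blast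
    then have "{L \<in> K. p \<in> L} = {}" "{L \<in> K. p \<notin> L} = K" by auto
    then have "U = {} \<or> U = K" using U by (simp only:)
    then show ?thesis using whole by (elim disjE) simp_all
  qed
qed

text \<open>Leaving \<open>X\<close> is witnessed by one point, failure of downward closure by
  two.\<close>

lemma compact_down_sets: "compact_space (cut_topology K)"
proof (rule compact_space_cut_topology)
  fix L assume "L \<notin> K"
  then consider x where "x \<in> L" "x \<notin> X" | x y where "x \<in> L" "(y, x) \<in> r" "y \<notin> L"
    by (auto simp: down_sets_def)
  then show "\<exists>F. finite F \<and> (\<forall>M. M \<inter> F = L \<inter> F \<longrightarrow> M \<notin> K)"
  proof cases
    case 1
    have "M \<notin> K" if "M \<inter> {x} = L \<inter> {x}" for M using that 1 down_setD(1)[of M x] by auto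
    then show ?thesis by (intro exI[of _ "{x}"]) simp
  next
    case 2
    have "M \<notin> K" if "M \<inter> {x, y} = L \<inter> {x, y}" for M
    proof -
      have "x \<in> M" "y \<notin> M" using that 2 by auto
      then show ?thesis using down_setD(2)[of M x y] 2(2) by blast
    qed
    then show ?thesis by (intro exI[of _ "{x, y}"]) simp
  qed
qed

lemma orderly:
  assumes G: "subgroup G (linear_Aut X r)"
  shows "orderly TYPE('a set) ((linear_Aut X r)\<lparr>carrier := G\<rparr>) (pointwise_topology X G)"
proof -
  have "linear_Aut X r = (BijGroup X)\<lparr>carrier := carrier (linear_Aut X r)\<rparr>"
    by (simp add: linear_Aut_def)
  then have sub: "subgroup G (BijGroup X)"
    using group.incl_subgroup[OF group_BijGroup subgroup_linear_Aut] G by metis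
  interpret bij_subgroup X G by (rule bij_subgroup.intro[OF sub])
  have mono: "(g x, g y) \<in> r \<longleftrightarrow> (x, y) \<in> r" if "g \<in> G" "x \<in> X" "y \<in> X" for g x y
    using subgroup.subset[OF G] that by (auto simp: linear_Aut_def)
  interpret point_action X G X "\<lambda>g. g" K
  proof unfold_locales
    fix p assume p: "p \<in> X"
    show "\<exists>F. finite F \<and> F \<subseteq> X \<and> (\<forall>g\<in>G. \<forall>h\<in>G. (\<forall>x\<in>F. g x = h x) \<longrightarrow> g p = h p)"
      using p by (intro exI[of _ "{p}"]) simp
    show "\<exists>q\<in>X. \<forall>g\<in>G. \<forall>h\<in>G. (\<forall>L\<in>K. h q \<in> g ` L \<longleftrightarrow> q \<in> L) \<longrightarrow> g p = h p"
    proof (intro bexI[OF _ p] ballI impI)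
      fix g h
      assume gh: "g \<in> G" "h \<in> G" "\<forall>L\<in>K. h p \<in> g ` L \<longleftrightarrow> p \<in> L"
      \<comment> \<open>Evaluated at the cuts just above and just below \<open>p\<close>, the
        premise writes \<open>h p\<close> as \<open>g u\<close> with \<open>u\<close> at most
        \<open>p\<close> but not below it, so \<open>u = p\<close>.\<close>
      have "h p \<in> g ` {y. (y, p) \<in> r}" "h p \<notin> g ` {y. (y, p) \<in> r \<and> y \<noteq> p}"
        using gh(3)[rule_format, OF principal_down_sets(1)[OF p]]
          gh(3)[rule_format, OF principal_down_sets(2)[OF p]] refl[OF p] by simp_all
      then show "g p = h p" by auto
    qed
  next
    fix g L assume g: "g \<in> G" and L: "L \<in> K"
    show "g ` L \<in> K"
      unfolding down_sets_def
    proof (intro CollectI conjI allI impI)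
      show "g ` L \<subseteq> X" using mem[OF g] down_setD(1)[OF L] by blast
      fix x y assume "x \<in> g ` L" "(y, x) \<in> r"
      then obtain u where u: "u \<in> L" "x = g u" by blast
      have "y \<in> X" using rel_mem \<open>(y, x) \<in> r\<close> by blast
      then obtain v where v: "v \<in> X" "y = g v" using surj[OF g] by blast
      have "(v, u) \<in> r" using mono[OF g v(1)] u v down_setD(1)[OF L] \<open>(y, x) \<in> r\<close> by blast
      then show "y \<in> g ` L" using v(2) down_setD(2)[OF L u(1)] by blast
    qed
  qed (use down_setD(1) mem compact_down_sets in \<open>auto simp: compose_eq\<close>)
  let ?H = "carrier (linear_Homeo K \<rho>)"
  have act_mono: "(act g L, act g M) \<in> \<rho> \<longleftrightarrow> (L, M) \<in> \<rho>" if "g \<in> G" "L \<in> K" "M \<in> K" for g L M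
  proof -
    have "g ` L \<subseteq> g ` M \<longleftrightarrow> L \<subseteq> M"
    proof
      assume sub: "g ` L \<subseteq> g ` M"
      show "L \<subseteq> M"
      proof
        fix p assume p: "p \<in> L"
        then have "g p \<in> g ` M" using sub by blast
        then show "p \<in> M" using mem_image[OF that(1,3)] K_subset[OF that(2)] p by blast
      qed
    qed blast
    then show ?thesis using that K_invariant by (simp add: act_def inclusion_order_def)
  qed
  have "act ` G \<subseteq> ?H"
    using act_Bij homeomorphic_map_act act_mono
    by (auto simp: linear_Homeo_def linear_Aut_def interval_topology_down_sets)
  moreover have "?H \<subseteq> Bij K" by (auto simp: linear_Homeo_def linear_Aut_def)
  ultimately have "topological_group_embedding ((BijGroup X)\<lparr>carrier := G\<rparr>) (pointwise_topology X G)
    ((BijGroup K)\<lparr>carrier := ?H\<rparr>) (compact_open_topology (cut_topology K) (cut_topology K) ?H) act"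
    by (rule topological_group_embedding_act)
  moreover have "(BijGroup K)\<lparr>carrier := ?H\<rparr> = linear_Homeo K \<rho>"
    by (simp add: linear_Homeo_def)
  moreover have "compact_linearly_ordered_space K \<rho>"
    using linear_order_inclusion compact_down_sets
    by (simp add: compact_linearly_ordered_space_def interval_topology_down_sets)
  ultimately show ?thesis
    unfolding orderly_def linear_Aut_carrier_update interval_topology_down_sets[symmetric]
    using topological_group by auto
qed

end

section \<open>Circular orders\<close>

text \<open>A cut of a circular order is a strict linear order from which it arises by closing up the
  line; it stands for the gap of the circle at which the circle is opened.\<close>

definition cuts :: "'a set \<Rightarrow> ('a \<times> 'a \<times> 'a) set \<Rightarrow> 'a rel set" where
  "cuts X R = {L. L \<subseteq> X \<times> X \<and> (\<forall>x y z. (x, y) \<in> L \<longrightarrow> (y, z) \<in> L \<longrightarrow> (x, z) \<in> L) \<and>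
     (\<forall>x\<in>X. \<forall>y\<in>X. x \<noteq> y \<longrightarrow> (x, y) \<in> L \<or> (y, x) \<in> L) \<and>
     (\<forall>x y z. (x, y) \<in> L \<longrightarrow> (y, z) \<in> L \<longrightarrow> (x, y, z) \<in> R)}"

text \<open>Around the circle the gaps and witnesses come in the order \<open>L\<close>,
  \<open>x\<close>, \<open>M\<close>, \<open>y\<close>, \<open>N\<close>, \<open>z\<close>: opened
  at the three gaps, the triple reads xyz, yzx and zxy. This form is visibly cyclic and visibly
  preserved by automorphisms.\<close>

definition cut_order :: "'a rel set \<Rightarrow> ('a rel \<times> 'a rel \<times> 'a rel) set" where
  "cut_order K = {(L, M, N). L \<in> K \<and> M \<in> K \<and> N \<in> K \<and>
     (\<exists>x y z. (x, y) \<in> L \<and> (y, z) \<in> L \<and> (y, z) \<in> M \<and> (z, x) \<in> M \<and> (z, x) \<in> N \<and> (x, y) \<in> N)}"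

text \<open>The points that one passes on the way from the gap \<open>L\<close> to the gap \<open>M\<close>.\<close>

definition arc :: "'a rel \<Rightarrow> 'a rel \<Rightarrow> 'a set" where
  "arc L M = {x. \<exists>y. (x, y) \<in> L \<and> (y, x) \<in> M}"

locale circular_ordered_set =
  fixes X :: "'a set" and R :: "('a \<times> 'a \<times> 'a) set"
  assumes circular_order: "circular_order_on X R"
begin

lemma rel_mem: "(x, y, z) \<in> R \<Longrightarrow> x \<in> X \<and> y \<in> X \<and> z \<in> X"
  using circular_order[unfolded circular_order_on_def, THEN conjunct1] by auto

lemma cyc: "(x, y, z) \<in> R \<Longrightarrow> (y, z, x) \<in> R"
  using circular_order[unfolded circular_order_on_def, THEN conjunct2, THEN conjunct1] by simp

lemma asym: "(x, y, z) \<in> R \<Longrightarrow> (y, x, z) \<notin> R"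
  using circular_order[unfolded circular_order_on_def, THEN conjunct2, THEN conjunct2, THEN conjunct1]
  by simp

lemma tr: "(x, y, z) \<in> R \<Longrightarrow> (x, z, w) \<in> R \<Longrightarrow> (x, y, w) \<in> R"
  using circular_order[unfolded circular_order_on_def, THEN conjunct2, THEN conjunct2,
    THEN conjunct2, THEN conjunct1, rule_format] .

lemma tot:
  "x \<in> X \<Longrightarrow> y \<in> X \<Longrightarrow> z \<in> X \<Longrightarrow> x \<noteq> y \<Longrightarrow> y \<noteq> z \<Longrightarrow> x \<noteq> z \<Longrightarrow> (x, y, z) \<in> R \<or> (x, z, y) \<in> R"
  using circular_order[unfolded circular_order_on_def, THEN conjunct2, THEN conjunct2,
    THEN conjunct2, THEN conjunct2, rule_format] .

lemma rel_distinct: "(x, y, z) \<in> R \<Longrightarrow> x \<noteq> y \<and> y \<noteq> z \<and> x \<noteq> z"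
  using asym cyc by metis

abbreviation K where "K \<equiv> cuts X R"

section \<open>Cuts compared by the arcs between them\<close>

lemma cut_mem: "L \<in> K \<Longrightarrow> (x, y) \<in> L \<Longrightarrow> x \<in> X \<and> y \<in> X"
  unfolding cuts_def by auto

lemma cut_trans: "L \<in> K \<Longrightarrow> (x, y) \<in> L \<Longrightarrow> (y, z) \<in> L \<Longrightarrow> (x, z) \<in> L"
  unfolding cuts_def by simp

lemma cut_total: "L \<in> K \<Longrightarrow> x \<in> X \<Longrightarrow> y \<in> X \<Longrightarrow> x \<noteq> y \<Longrightarrow> (x, y) \<in> L \<or> (y, x) \<in> L"
  unfolding cuts_def by simp

lemma cut_rel: "L \<in> K \<Longrightarrow> (x, y) \<in> L \<Longrightarrow> (y, z) \<in> L \<Longrightarrow> (x, y, z) \<in> R"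
  unfolding cuts_def by simp

lemma cut_irrefl: "L \<in> K \<Longrightarrow> (x, x) \<notin> L"
  using cut_rel rel_distinct by metis

lemma cut_asym: "L \<in> K \<Longrightarrow> (x, y) \<in> L \<Longrightarrow> (y, x) \<notin> L"
  using cut_rel rel_distinct by metis

text \<open>Of a pair reversed between \<open>L\<close> and \<open>M\<close>, only the point that
  comes earlier in \<open>L\<close> is passed. If \<open>y\<close> were passed too, with witness
  \<open>w\<close>, then \<open>L\<close> and \<open>M\<close> would orient \<open>x\<close>,
  \<open>y\<close>, \<open>w\<close> oppositely.\<close>

lemma reversed_not_mem_arc:
  assumes "L \<in> K" "M \<in> K" "(x, y) \<in> L" "(y, x) \<in> M"
  shows "y \<notin> arc L M"
proof
  assume "y \<in> arc L M"
  then obtain w where "(y, w) \<in> L" "(w, y) \<in> M" by (auto simp: arc_def)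
  then have "(x, y, w) \<in> R" "(w, y, x) \<in> R" using cut_rel assms by metis+
  then show False using cyc asym by metis
qed

text \<open>Going from \<open>L\<close> to \<open>M\<close> takes the block of passed points from
  the beginning of the line and appends it at the end, so a passed point and an unpassed one change
  places. Any other arrangement orients some triple in two ways.\<close>

lemma reversed_across_arc:
  assumes LM: "L \<in> K" "M \<in> K" and x: "x \<in> arc L M" and y: "y \<in> X" "y \<notin> arc L M"
  shows "(x, y) \<in> L" "(y, x) \<in> M"
proof -
  obtain w where w: "(x, w) \<in> L" "(w, x) \<in> M" using x by (auto simp: arc_def)
  have xX: "x \<in> X" using cut_mem[OF LM(1) w(1)] by simp
  have neq: "x \<noteq> y" using x y(2) by blast
  have ny: "(w, y) \<notin> M" if "(y, w) \<in> L" for w using y(2) that by (auto simp: arc_def)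
  \<comment> \<open>An unpassed \<open>y\<close> precedes in \<open>M\<close> whatever it precedes
    in \<open>L\<close>.\<close>
  have agree: "(y, v) \<in> M" if "(y, v) \<in> L" for v
    using ny[OF that] cut_total[OF LM(2), of v y] cut_mem[OF LM(1) that] cut_irrefl[OF LM(1)] that
    by metis
  show xy: "(x, y) \<in> L"
  proof (rule ccontr)
    assume "(x, y) \<notin> L"
    then have yx: "(y, x) \<in> L" using cut_total[OF LM(1) xX y(1) neq] by blast
    then have "(y, w) \<in> M" using agree cut_trans[OF LM(1) yx w(1)] by blast
    then have "(y, w, x) \<in> R" using cut_rel[OF LM(2) _ w(2)] by blast
    moreover have "(y, x, w) \<in> R" using cut_rel[OF LM(1) yx w(1)] .
    ultimately show False using cyc asym by metis
  qed
  show "(y, x) \<in> M"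
  proof (rule ccontr)
    assume "(y, x) \<notin> M"
    then have xyM: "(x, y) \<in> M" using cut_total[OF LM(2) xX y(1) neq] by blast
    then have wy: "(w, y) \<in> M" "(w, x, y) \<in> R"
      using cut_trans[OF LM(2) w(2)] cut_rel[OF LM(2) w(2)] by blast+
    then have "w \<noteq> y" using cut_irrefl[OF LM(2)] by metis
    moreover have "(y, w) \<notin> L" using ny wy(1) by blast
    ultimately have "(w, y) \<in> L"
      using cut_total[OF LM(1), of w y] cut_mem[OF LM(1) w(1)] y(1) by blast
    then have "(x, w, y) \<in> R" using cut_rel[OF LM(1) w(1)] by blast
    then show False using wy(2) asym by metis
  qed
qed

lemma arc_subset_X: "L \<in> K \<Longrightarrow> arc L M \<subseteq> X"
  using cut_mem by (auto simp: arc_def)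

lemma arc_self: "L \<in> K \<Longrightarrow> arc L L = {}"
  using cut_asym by (auto simp: arc_def)

text \<open>Arcs that start at \<open>L\<close> are initial segments of \<open>L\<close>, hence
  nested. If neither contained the other, a point of each difference would have to precede the other
  in \<open>L\<close>.\<close>

lemma arcs_chain:
  assumes "L \<in> K" "M \<in> K" "N \<in> K" "x \<in> arc L N" "x \<notin> arc L M"
  shows "arc L M \<subset> arc L N"
proof
  have xX: "x \<in> X" using arc_subset_X assms(1,4) by blast
  show "arc L M \<subseteq> arc L N"
  proof (rule ccontr)
    assume "\<not> arc L M \<subseteq> arc L N"
    then obtain y where y: "y \<in> arc L M" "y \<notin> arc L N" by blast
    then have "y \<in> X" using arc_subset_X assms(1) by blast
    then have "(y, x) \<in> L" "(x, y) \<in> L"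
      using reversed_across_arc(1)[OF assms(1,2) y(1) xX assms(5)]
        reversed_across_arc(1)[OF assms(1,3,4) _ y(2)] by blast+
    then show False using cut_asym assms(1) by metis
  qed
qed (use assms in blast)

text \<open>\<open>M\<close> is recovered from \<open>L\<close> by reversing precisely the pairs
  that consist of a passed point and a later unpassed one.\<close>

lemma arc_eqD:
  assumes "L \<in> K" "M \<in> K" "N \<in> K" "arc L M = arc L N"
  shows "M = N"
proof -
  have "M \<subseteq> N" if MN: "M \<in> K" "N \<in> K" "arc L M = arc L N" for M N
  proof (intro subrelI)
    fix u v assume uv: "(u, v) \<in> M"
    have X: "u \<in> X" "v \<in> X" "u \<noteq> v" using cut_mem[OF MN(1) uv] cut_irrefl[OF MN(1)] uv by auto
    show "(u, v) \<in> N"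
    proof (cases "(u, v) \<in> L")
      case True
      have False if "(v, u) \<in> N"
      proof -
        have "u \<in> arc L M" using True that MN(3) by (auto simp: arc_def)
        moreover have "v \<notin> arc L M"
          using reversed_not_mem_arc[OF assms(1) MN(2) True that] MN(3) by simp
        ultimately have "(v, u) \<in> M" using reversed_across_arc(2)[OF assms(1) MN(1)] X by blast
        then show False using cut_asym[OF MN(1) uv] by blast
      qed
      then show ?thesis using cut_total[OF MN(2) X] by blast
    next
      case False
      then have vu: "(v, u) \<in> L" using cut_total[OF assms(1) X] by blast
      then have "v \<in> arc L N" using uv MN(3) by (auto simp: arc_def)
      moreover have "u \<notin> arc L N" using reversed_not_mem_arc[OF assms(1) MN(1) vu uv] MN(3) by simp
      ultimately show ?thesis using reversed_across_arc(2)[OF assms(1) MN(2)] X by blast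
    qed
  qed
  from this[OF assms(2-4)] this[OF assms(3,2) assms(4)[symmetric]] show ?thesis by blast
qed

text \<open>Seen from the gap \<open>L\<close>, the circle of gaps is a line ordered by how far the
  arc reaches. The condition \<open>L \<noteq> M\<close> is needed because \<open>arc L L\<close> is
  empty and would be strictly contained in every other arc.\<close>

lemma cut_order_iff:
  "(L, M, N) \<in> cut_order K \<longleftrightarrow> L \<in> K \<and> M \<in> K \<and> N \<in> K \<and> L \<noteq> M \<and> arc L M \<subset> arc L N"
proof
  assume "(L, M, N) \<in> cut_order K"
  then obtain x y z where K: "L \<in> K" "M \<in> K" "N \<in> K" and *: "(x, y) \<in> L" "(y, z) \<in> L"
    "(y, z) \<in> M" "(z, x) \<in> M" "(z, x) \<in> N" "(x, y) \<in> N"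
    by (auto simp: cut_order_def)
  have yx: "(y, x) \<in> M" using cut_trans[OF K(2) *(3,4)] .
  have "(z, y) \<in> N" using cut_trans[OF K(3) *(5,6)] .
  then have "y \<in> arc L N" using *(2) by (auto simp: arc_def)
  moreover have "y \<notin> arc L M" using reversed_not_mem_arc[OF K(1,2) *(1) yx] .
  moreover have "L \<noteq> M" using cut_asym[OF K(1) *(1)] yx by blast
  ultimately show "L \<in> K \<and> M \<in> K \<and> N \<in> K \<and> L \<noteq> M \<and> arc L M \<subset> arc L N"
    using arcs_chain[OF K] K by blast
next
  assume "L \<in> K \<and> M \<in> K \<and> N \<in> K \<and> L \<noteq> M \<and> arc L M \<subset> arc L N"
  then have K: "L \<in> K" "M \<in> K" "N \<in> K" and "L \<noteq> M" and sub: "arc L M \<subset> arc L N" by simp_all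
  then have "arc L M \<noteq> {}" using arc_eqD[OF K(1,1,2)] arc_self by auto
  \<comment> \<open>One witness from each stretch: \<open>x\<close> between \<open>L\<close> and
    \<open>M\<close>, \<open>y\<close> between \<open>M\<close> and \<open>N\<close>, and
    \<open>z\<close> between \<open>N\<close> and \<open>L\<close>; the last is the point that
    certifies \<open>y \<in> arc L N\<close>.\<close>
  then obtain x where x: "x \<in> arc L M" by blast
  obtain y where y: "y \<in> arc L N" "y \<notin> arc L M" using sub by blast
  obtain z where z: "(y, z) \<in> L" "(z, y) \<in> N" using y(1) by (auto simp: arc_def)
  have X: "y \<in> X" "z \<in> X" using cut_mem[OF K(1) z(1)] by simp_all
  have zN: "z \<notin> arc L N" using reversed_not_mem_arc[OF K(1,3) z] .
  then have zM: "z \<notin> arc L M" using sub by blast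
  have xN: "x \<in> arc L N" using x sub by blast
  have xy: "(x, y) \<in> L" "(y, x) \<in> M" using reversed_across_arc[OF K(1,2) x X(1) y(2)] .
  have zx: "(z, x) \<in> M" using reversed_across_arc(2)[OF K(1,2) x X(2) zM] .
  have zxN: "(z, x) \<in> N" using reversed_across_arc(2)[OF K(1,3) xN X(2) zN] .
  have "(z, y) \<notin> M" using y(2) z(1) by (auto simp: arc_def)
  then have yz: "(y, z) \<in> M" using cut_total[OF K(2) X] cut_irrefl[OF K(1)] z(1) by metis
  have "(y, x) \<notin> N"
    using reversed_not_mem_arc[OF K(1,3) xy(1)] y(1) by blast
  moreover have "x \<in> X" "x \<noteq> y" using cut_mem[OF K(1) xy(1)] cut_irrefl[OF K(1)] xy(1) by auto
  ultimately have "(x, y) \<in> N" using cut_total[OF K(3) _ X(1)] by blast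
  then show "(L, M, N) \<in> cut_order K"
    unfolding cut_order_def using K xy(1) z(1) yz zx zxN by blast
qed

text \<open>Cyclicity is read off the symmetric definition; the other axioms come from inclusion of
  arcs with common start \<open>L\<close>, where totality needs that distinct gaps have distinct
  arcs.\<close>

lemma circular_order_cut_order: "circular_order_on K (cut_order K)"
  unfolding circular_order_on_def
proof (intro conjI allI impI ballI)
  show "cut_order K \<subseteq> K \<times> K \<times> K" by (auto simp: cut_order_def)
  show cycK: "(M, N, L) \<in> cut_order K" if "(L, M, N) \<in> cut_order K" for L M N
  proof -
    from that obtain x y z where "L \<in> K" "M \<in> K" "N \<in> K" "(x, y) \<in> L" "(y, z) \<in> L"
      "(y, z) \<in> M" "(z, x) \<in> M" "(z, x) \<in> N" "(x, y) \<in> N"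
      unfolding cut_order_def by (elim CollectE case_prodE conjE exE) simp
    then show ?thesis
      unfolding cut_order_def
      by (intro CollectI case_prodI conjI exI[of _ y] exI[of _ z] exI[of _ x])
  qed
  show "(M, L, N) \<notin> cut_order K" if "(L, M, N) \<in> cut_order K" for L M N
  proof
    assume "(M, L, N) \<in> cut_order K"
    then have "(L, N, M) \<in> cut_order K" by (rule cycK)
    with that show False by (simp add: cut_order_iff psubset_eq) blast
  qed
  show "(L, M, Q) \<in> cut_order K" if "(L, M, N) \<in> cut_order K" "(L, N, Q) \<in> cut_order K" for L M N Q
    using that psubset_trans by (simp add: cut_order_iff) blast
  show "(L, M, N) \<in> cut_order K \<or> (L, N, M) \<in> cut_order K"
    if K: "L \<in> K" "M \<in> K" "N \<in> K" and ne: "L \<noteq> M" "M \<noteq> N" "L \<noteq> N" for L M N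
  proof -
    have "arc L M \<noteq> arc L N" using arc_eqD[OF K] ne(2) by blast
    then have "arc L M \<subset> arc L N \<or> arc L N \<subset> arc L M"
      using arcs_chain[OF K] arcs_chain[OF K(1,3,2)] by blast
    then show ?thesis using K ne by (simp add: cut_order_iff)
  qed
qed

text \<open>The gaps adjacent to \<open>x\<close>: the circle opened just before \<open>x\<close>,
  so that \<open>x\<close> is the least element, and below, in \<open>after\<close>, just behind it,
  so that \<open>x\<close> is the greatest. The remaining points are ordered as seen from
  \<open>x\<close> in both.\<close>

definition before :: "'a \<Rightarrow> 'a rel" where
  "before x = {(u, v). u \<in> X \<and> v \<in> X \<and> u \<noteq> v \<and> (u = x \<or> (x, u, v) \<in> R)}"

definition after :: "'a \<Rightarrow> 'a rel" where
  "after x = {(u, v). u \<in> X \<and> v \<in> X \<and> u \<noteq> v \<and> (v = x \<or> (x, u, v) \<in> R)}"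

lemma rel_transfer: "(x, u, v) \<in> R \<Longrightarrow> (x, v, w) \<in> R \<Longrightarrow> (u, v, w) \<in> R"
  using cyc tr by metis

lemma before_mem:
  assumes "x \<in> X"
  shows "before x \<in> K"
  unfolding cuts_def
proof (intro CollectI conjI allI ballI impI)
  show "before x \<subseteq> X \<times> X" by (auto simp: before_def)
  show "(u, v) \<in> before x \<or> (v, u) \<in> before x" if "u \<in> X" "v \<in> X" "u \<noteq> v" for u v
    using tot[OF assms that(1,2)] that by (auto simp: before_def)
  fix u v w assume *: "(u, v) \<in> before x" "(v, w) \<in> before x"
  then have "v \<noteq> x" using rel_distinct by (auto simp: before_def)
  then have v: "(x, v, w) \<in> R" and u: "u = x \<or> (x, u, v) \<in> R"
    and X: "u \<in> X" "w \<in> X" using * by (auto simp: before_def)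
  show "(u, v, w) \<in> R" using u v rel_transfer by metis
  show "(u, w) \<in> before x" using u v tr[of x u v w] rel_distinct X by (auto simp: before_def)
qed

lemma after_mem:
  assumes "x \<in> X"
  shows "after x \<in> K"
  unfolding cuts_def
proof (intro CollectI conjI allI ballI impI)
  show "after x \<subseteq> X \<times> X" by (auto simp: after_def)
  show "(u, v) \<in> after x \<or> (v, u) \<in> after x" if "u \<in> X" "v \<in> X" "u \<noteq> v" for u v
    using tot[OF assms that(1,2)] that by (auto simp: after_def)
  fix u v w assume *: "(u, v) \<in> after x" "(v, w) \<in> after x"
  then have "v \<noteq> x" using rel_distinct by (auto simp: after_def)
  then have u: "(x, u, v) \<in> R" and w: "w = x \<or> (x, v, w) \<in> R"
    and X: "u \<in> X" "w \<in> X" using * by (auto simp: after_def)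
  show "(u, v, w) \<in> R" using u w rel_transfer cyc by metis
  show "(u, w) \<in> after x" using u w tr[of x u v w] rel_distinct X by (auto simp: after_def)
qed

lemma mem_before_after:
  assumes "x \<in> X" "y \<in> X" "x \<noteq> y"
  shows "(x, y) \<in> before x" "(y, x) \<notin> before x" "(y, x) \<in> after x" "(x, y) \<notin> after x"
  using assms rel_distinct by (auto simp: before_def after_def)

text \<open>A line opened at a gap meets \<open>y\<close> before \<open>x\<close> iff the gap lies
  on the way from \<open>x\<close> to \<open>y\<close>. The extreme gaps are those adjacent to
  \<open>x\<close> and \<open>y\<close>, which is why a closed arc results.\<close>

lemma cuts_eq_closed_arc:
  assumes "x \<in> X" "y \<in> X" "x \<noteq> y"
  shows "{L \<in> K. (y, x) \<in> L} = closed_arc (cut_order K) (after x) (before y)"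
proof (intro Set.set_eqI iffI)
  note x = after_mem[OF assms(1)] and y = before_mem[OF assms(2)]
  fix L assume "L \<in> {L \<in> K. (y, x) \<in> L}"
  then have L: "L \<in> K" "(y, x) \<in> L" by simp_all
  show "L \<in> closed_arc (cut_order K) (after x) (before y)"
  proof (rule ccontr)
    assume n: "L \<notin> closed_arc (cut_order K) (after x) (before y)"
    then have neq: "L \<noteq> after x" "L \<noteq> before y" and "(after x, L, before y) \<notin> cut_order K"
      by (auto simp: closed_arc_def open_arc_def)
    then have "\<not> arc (after x) L \<subset> arc (after x) (before y)"
      using x y L by (simp add: cut_order_iff)
    moreover have "arc (after x) L \<noteq> arc (after x) (before y)"
      using arc_eqD[OF x L(1) y] neq(2) by blast
    \<comment> \<open>The walk to \<open>L\<close> passes \<open>u\<close> but not \<open>y\<close>,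
      so \<open>u\<close> precedes \<open>y\<close> in \<open>after x\<close>; but all such points
      are passed on the way to \<open>before y\<close>.\<close>
    ultimately obtain u where u: "u \<in> arc (after x) L" "u \<notin> arc (after x) (before y)" by blast
    have "y \<notin> arc (after x) L"
    proof
      assume yL: "y \<in> arc (after x) L"
      \<comment> \<open>\<open>x\<close> is the last point of \<open>after x\<close>, so it precedes
        nothing there.\<close>
      have "x \<notin> arc (after x) L"
        using rel_distinct by (auto simp: arc_def after_def)
      from reversed_across_arc(2)[OF x L(1) yL assms(1) this] show False
        using cut_asym[OF L] by blast
    qed
    from reversed_across_arc[OF x L(1) u(1) assms(2) this]
    have uy: "(u, y) \<in> after x" "(y, u) \<in> L" .
    then have "u \<in> X" "u \<noteq> y" by (auto simp: after_def)
    then have "(y, u) \<in> before y" using mem_before_after(1)[OF assms(2)] by blast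
    then show False using u(2) uy(1) by (auto simp: arc_def)
  qed
next
  note x = after_mem[OF assms(1)] and y = before_mem[OF assms(2)]
  fix L assume "L \<in> closed_arc (cut_order K) (after x) (before y)"
  then consider "L = after x" | "L = before y" | "(after x, L, before y) \<in> cut_order K"
    by (auto simp: closed_arc_def open_arc_def)
  then show "L \<in> {L \<in> K. (y, x) \<in> L}"
  proof cases
    case 1
    then show ?thesis using x mem_before_after(3)[OF assms] by simp
  next
    case 2
    then show ?thesis using y mem_before_after(1)[OF assms(2,1)] assms(3) by simp
  next
    case 3
    then have L: "L \<in> K" "arc (after x) L \<subset> arc (after x) (before y)"
      by (simp_all add: cut_order_iff)
    have "(x, y) \<notin> L"
    proof
      assume "(x, y) \<in> L"
      then have "y \<in> arc (after x) L" using mem_before_after(3)[OF assms] by (auto simp: arc_def)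
      then have "y \<in> arc (after x) (before y)" using L(2) by blast
      \<comment> \<open>Nothing precedes \<open>y\<close> in \<open>before y\<close>, so
        \<open>y\<close> is not passed on the way there.\<close>
      then show False using rel_distinct by (auto simp: arc_def before_def)
    qed
    then show ?thesis using L(1) cut_total[OF L(1) assms] by simp
  qed
qed

text \<open>By totality, containing a pair of distinct points means omitting the reversed pair, and
  the cuts omitting such a pair form the complement of a closed arc. For the other inclusion, lying
  outside a closed arc is certified by finitely many pairs.\<close>

lemma circular_topology_cuts: "circular_topology K (cut_order K) = cut_topology K"
  unfolding circular_topology_def cut_topology_def
proof (rule topology_generated_by_eqI, fold circular_topology_def cut_topology_def)
  fix U assume "U \<in> circular_base K (cut_order K)"
  then consider "U = K" | M N where "M \<in> K" "N \<in> K" "U = K - closed_arc (cut_order K) M N"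
    unfolding circular_base_def by (elim insertE CollectE exE conjE) simp_all
  then show "openin (cut_topology K) U"
  proof cases
    case 1
    then show ?thesis using openin_topspace[of "cut_topology K"] by simp
  next
    case 2
    note U = 2
    show ?thesis
    proof (subst openin_subopen, intro ballI)
      fix L assume "L \<in> U"
      then have L: "L \<in> K" "L \<noteq> M" "L \<noteq> N" "(M, L, N) \<notin> cut_order K"
        by (auto simp: U closed_arc_def open_arc_def)
      show "\<exists>V. openin (cut_topology K) V \<and> L \<in> V \<and> V \<subseteq> U"
      proof (cases "M = N")
        case True
        \<comment> \<open>Here the closed arc is the single gap \<open>M\<close>. Both cuts are
          total strict orders, so inclusion would force equality.\<close>
        have "\<not> L \<subseteq> M"
        proof
          assume sub: "L \<subseteq> M"
          have "M \<subseteq> L"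
          proof (intro subrelI)
            fix u v assume "(u, v) \<in> M"
            then have "u \<in> X" "v \<in> X" "u \<noteq> v" "(v, u) \<notin> L"
              using cut_mem[OF U(1)] cut_irrefl[OF U(1)] cut_asym[OF U(1)] sub by blast+
            then show "(u, v) \<in> L" using cut_total[OF L(1)] by blast
          qed
          then show False using sub L(2) by blast
        qed
        then obtain p where p: "p \<in> L" "p \<notin> M" by blast
        have "{L \<in> K. p \<in> L} \<subseteq> U"
        proof
          fix L' assume L': "L' \<in> {L \<in> K. p \<in> L}"
          moreover have "(M, L', M) \<notin> cut_order K" by (simp add: cut_order_iff arc_self)
          ultimately show "L' \<in> U"
            using p(2) by (auto simp: U True[symmetric] closed_arc_def open_arc_def)
        qed
        then show ?thesis using openin_cut_topology_mem(1)[of K p] p(1) L(1)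
          by (intro exI[of _ "{L \<in> K. p \<in> L}"]) simp
      next
        case False
        note circ = circular_order_cut_order
        \<comment> \<open>The gaps form a circular order themselves, so the axioms of the locale
          become available one level up.\<close>
        interpret K: circular_ordered_set K "cut_order K" by (rule circular_ordered_set.intro[OF circ])
        have "(M, N, L) \<in> cut_order K" using K.tot[OF U(1) L(1) U(2)] L False by blast
        then obtain x y z where xyz: "(x, y) \<in> M" "(y, z) \<in> M" "(y, z) \<in> N" "(z, x) \<in> N"
          "(z, x) \<in> L" "(x, y) \<in> L"
          by (auto simp: cut_order_def)
        \<comment> \<open>These are the two pairs that \<open>L\<close> contributes to the witness
          of \<open>(M, N, L)\<close>; every cut containing them lies on the same side.\<close>
        let ?V = "{L \<in> K. (z, x) \<in> L} \<inter> {L \<in> K. (x, y) \<in> L}"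
        have "?V \<subseteq> U"
        proof
          fix L' assume L': "L' \<in> ?V"
          then have "(M, N, L') \<in> cut_order K"
            using U(1,2) xyz unfolding cut_order_def by blast
          then have "L' \<noteq> M" "L' \<noteq> N" "(M, L', N) \<notin> cut_order K"
            using K.rel_distinct K.asym K.cyc by metis+
          then show "L' \<in> U" using L' by (simp add: U closed_arc_def open_arc_def)
        qed
        moreover have "openin (cut_topology K) ?V"
          by (intro openin_Int openin_cut_topology_mem)
        ultimately show ?thesis using xyz(5,6) L(1) by (intro exI[of _ ?V]) simp
      qed
    qed
  qed
next
  fix U
  assume "U \<in> {U. \<exists>p. U = {L \<in> K. p \<in> L} \<or> U = {L \<in> K. p \<notin> L}}"
  then obtain p where U: "U = {L \<in> K. p \<in> L} \<or> U = {L \<in> K. p \<notin> L}" by (elim CollectE exE)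
  obtain x y where p: "p = (x, y)" by (cases p)
  have whole: "openin (circular_topology K (cut_order K)) K"
    unfolding circular_topology_def
    by (rule topology_generated_by_Basis) (simp add: circular_base_def)
  have op: "openin (circular_topology K (cut_order K)) {L \<in> K. (u, v) \<notin> L}"
    if "u \<in> X" "v \<in> X" "u \<noteq> v" for u v
  proof -
    have "{L \<in> K. (u, v) \<notin> L} = K - {L \<in> K. (u, v) \<in> L}" by auto
    also have "\<dots> = K - closed_arc (cut_order K) (after v) (before u)"
      using cuts_eq_closed_arc[OF that(2,1)] that(3) by simp
    finally show ?thesis
      unfolding circular_topology_def circular_base_def
      using after_mem[OF that(2)] before_mem[OF that(1)]
      by (intro topology_generated_by_Basis insertI2 CollectI exI[of _ "after v"] exI[of _ "before u"])
        simp
  qed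
  show "openin (circular_topology K (cut_order K)) U"
  proof (cases "x \<in> X \<and> y \<in> X \<and> x \<noteq> y")
    case True
    have "(x, y) \<in> L \<longleftrightarrow> (y, x) \<notin> L" if "L \<in> K" for L
      using cut_total[OF that, of x y] cut_asym[OF that] True by blast
    then have "{L \<in> K. p \<in> L} = {L \<in> K. (y, x) \<notin> L}" by (simp add: p cong: conj_cong)
    then have "U = {L \<in> K. (y, x) \<notin> L} \<or> U = {L \<in> K. (x, y) \<notin> L}" using U by (simp add: p)
    moreover have xy: "x \<in> X" "y \<in> X" "x \<noteq> y" "y \<noteq> x" using True by auto
    ultimately show ?thesis using op[OF xy(1-3)] op[OF xy(2,1,4)] by (elim disjE) simp_all
  next
    case False
    then have "p \<notin> L" if "L \<in> K" for L
      using cut_mem[OF that, of x y] cut_irrefl[OF that] by (auto simp: p)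
    then have "{L \<in> K. p \<in> L} = {}" "{L \<in> K. p \<notin> L} = K" by auto
    then have "U = {} \<or> U = K" using U by (simp only:)
    then show ?thesis using whole by (elim disjE) simp_all
  qed
qed

text \<open>Each axiom in \<open>cuts\<close> concerns at most three pairs, so a violation persists
  in every relation that agrees with \<open>L\<close> on them.\<close>

lemma compact_cuts: "compact_space (cut_topology K)"
proof (rule compact_space_cut_topology)
  fix L assume "L \<notin> K"
  then consider p where "p \<in> L" "p \<notin> X \<times> X"
    | x y z where "(x, y) \<in> L" "(y, z) \<in> L" "(x, z) \<notin> L"
    | x y where "x \<in> X" "y \<in> X" "x \<noteq> y" "(x, y) \<notin> L" "(y, x) \<notin> L"
    | x y z where "(x, y) \<in> L" "(y, z) \<in> L" "(x, y, z) \<notin> R"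
    unfolding cuts_def by blast
  then show "\<exists>F. finite F \<and> (\<forall>M. M \<inter> F = L \<inter> F \<longrightarrow> M \<notin> K)"
  proof cases
    case 1
    have "M \<notin> K" if "M \<inter> {p} = L \<inter> {p}" for M
    proof
      assume "M \<in> K"
      moreover have "p \<in> M" using that 1 by auto
      ultimately show False using cut_mem[of M "fst p" "snd p"] 1(2) by (simp add: mem_Times_iff)
    qed
    then show ?thesis by (intro exI[of _ "{p}"]) simp
  next
    case 2
    have "M \<notin> K" if "M \<inter> {(x, y), (y, z), (x, z)} = L \<inter> {(x, y), (y, z), (x, z)}" for M
    proof -
      have "(x, y) \<in> M" "(y, z) \<in> M" "(x, z) \<notin> M" using that 2 by auto
      then show ?thesis using cut_trans by metis
    qed
    then show ?thesis by (intro exI[of _ "{(x, y), (y, z), (x, z)}"]) simp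
  next
    case 3
    have "M \<notin> K" if "M \<inter> {(x, y), (y, x)} = L \<inter> {(x, y), (y, x)}" for M
    proof -
      have "(x, y) \<notin> M" "(y, x) \<notin> M" using that 3 by auto
      then show ?thesis using cut_total[OF _ 3(1-3)] by metis
    qed
    then show ?thesis by (intro exI[of _ "{(x, y), (y, x)}"]) simp
  next
    case 4
    have "M \<notin> K" if "M \<inter> {(x, y), (y, z)} = L \<inter> {(x, y), (y, z)}" for M
    proof -
      have "(x, y) \<in> M" "(y, z) \<in> M" using that 4 by auto
      then show ?thesis using cut_rel 4(3) by metis
    qed
    then show ?thesis by (intro exI[of _ "{(x, y), (y, z)}"]) simp
  qed
qed

lemma c_orderly:
  assumes G: "subgroup G (circular_Aut X R)"
  shows "c_orderly TYPE(('a \<times> 'a) set) ((circular_Aut X R)\<lparr>carrier := G\<rparr>) (pointwise_topology X G)"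
proof -
  have "circular_Aut X R = (BijGroup X)\<lparr>carrier := carrier (circular_Aut X R)\<rparr>"
    by (simp add: circular_Aut_def)
  then have sub: "subgroup G (BijGroup X)"
    using group.incl_subgroup[OF group_BijGroup subgroup_circular_Aut] G by metis
  interpret bij_subgroup X G by (rule bij_subgroup.intro[OF sub])
  have preserves: "(g x, g y, g z) \<in> R" if "g \<in> G" "(x, y, z) \<in> R" for g x y z
    using subgroup.subset[OF G] that rel_mem[OF that(2)] by (auto simp: circular_Aut_def)
  have img: "(g x, g y) \<in> map_prod g g ` L" if "(x, y) \<in> L" for g x y and L :: "'a rel"
    using that by force
  interpret point_action X G "X \<times> X" "\<lambda>g. map_prod g g" K
  proof unfold_locales
    fix p assume p: "p \<in> X \<times> X"
    show "\<exists>F. finite F \<and> F \<subseteq> X \<and>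
        (\<forall>g\<in>G. \<forall>h\<in>G. (\<forall>x\<in>F. g x = h x) \<longrightarrow> map_prod g g p = map_prod h h p)"
      using p by (intro exI[of _ "{fst p, snd p}"]) auto
  next
    fix x assume x: "x \<in> X"
    show "\<exists>p\<in>X \<times> X. \<forall>g\<in>G. \<forall>h\<in>G.
        (\<forall>L\<in>K. map_prod h h p \<in> map_prod g g ` L \<longleftrightarrow> p \<in> L) \<longrightarrow> g x = h x"
    proof (cases "\<exists>y\<in>X. y \<noteq> x")
      case True
      then obtain y where y: "y \<in> X" "x \<noteq> y" by blast
      show ?thesis
      proof (intro bexI[of _ "(x, y)"] ballI impI)
        fix g h
        assume gh: "g \<in> G" "h \<in> G"
          "\<forall>L\<in>K. map_prod h h (x, y) \<in> map_prod g g ` L \<longleftrightarrow> (x, y) \<in> L"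
        have *: "(h x, h y) \<in> map_prod g g ` before x" "(h x, h y) \<notin> map_prod g g ` after x"
          using gh(3)[rule_format, OF before_mem[OF x]] gh(3)[rule_format, OF after_mem[OF x]]
            mem_before_after[OF x y] by simp_all
        then obtain u v where uv: "(u, v) \<in> before x" "h x = g u" "h y = g v" by auto
        then have "(u, v) \<notin> after x" using img[of u v "after x" g] *(2) by auto
        \<comment> \<open>\<open>before x\<close> and \<open>after x\<close> differ only in pairs
          that involve \<open>x\<close>; one lying in the former alone starts with
          \<open>x\<close>.\<close>
        then have "u = x" using uv(1) by (auto simp: before_def after_def)
        then show "g x = h x" using uv(2) by simp
      qed (use x y in simp)
    next
      case False
      \<comment> \<open>On a one-point circle there is no pair of distinct points to test, but
        \<open>g x\<close> and \<open>h x\<close> can only be \<open>x\<close>.\<close>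
      then have "g x = h x" if "g \<in> G" "h \<in> G" for g h using mem[OF _ x] that by metis
      then show ?thesis using x by blast
    qed
  next
    fix g L assume g: "g \<in> G" and L: "L \<in> K"
    have un: "\<exists>u v. (u, v) \<in> L \<and> x = g u \<and> y = g v" if "(x, y) \<in> map_prod g g ` L" for x y
      using that by auto
    show "map_prod g g ` L \<in> K"
      unfolding cuts_def
    proof (intro CollectI conjI allI ballI impI)
      show "map_prod g g ` L \<subseteq> X \<times> X" using mem[OF g] cut_mem[OF L] by auto
    next
      fix x y assume xy: "x \<in> X" "y \<in> X" "x \<noteq> y"
      then have "x \<in> g ` X" "y \<in> g ` X" using surj[OF g] by simp_all
      then obtain u v where uv: "u \<in> X" "v \<in> X" "x = g u" "y = g v" by blast
      then have "(u, v) \<in> L \<or> (v, u) \<in> L" using cut_total[OF L uv(1,2)] xy(3) by blast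
      then show "(x, y) \<in> map_prod g g ` L \<or> (y, x) \<in> map_prod g g ` L"
        unfolding uv(3,4) using img[of u v L g] img[of v u L g] by argo
    next
      fix x y z assume "(x, y) \<in> map_prod g g ` L" "(y, z) \<in> map_prod g g ` L"
      then obtain u v v' w where uv: "(u, v) \<in> L" "x = g u" "y = g v" "(v', w) \<in> L" "y = g v'" "z = g w"
        using un by metis
      then have "v' = v" using inj[OF g] cut_mem[OF L] by metis
      then have vw: "(v, w) \<in> L" using uv by simp
      show "(x, z) \<in> map_prod g g ` L" using img[OF cut_trans[OF L uv(1) vw]] uv by simp
      show "(x, y, z) \<in> R" using preserves[OF g cut_rel[OF L uv(1) vw]] uv by simp
    qed
  next
    fix L assume "L \<in> K"
    then show "L \<subseteq> X \<times> X" using cut_mem by auto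
  qed (use mem compact_cuts in \<open>auto simp: compose_eq\<close>)
  let ?H = "carrier (circular_Homeo K (cut_order K))"
  have act_mono: "(act g L, act g M, act g N) \<in> cut_order K"
    if "g \<in> G" "(L, M, N) \<in> cut_order K" for g L M N
  proof -
    from that(2) obtain x y z where K: "L \<in> K" "M \<in> K" "N \<in> K" and *: "(x, y) \<in> L" "(y, z) \<in> L"
      "(y, z) \<in> M" "(z, x) \<in> M" "(z, x) \<in> N" "(x, y) \<in> N"
      by (auto simp: cut_order_def)
    have "(g x, g y) \<in> act g L \<and> (g y, g z) \<in> act g L \<and> (g y, g z) \<in> act g M \<and>
        (g z, g x) \<in> act g M \<and> (g z, g x) \<in> act g N \<and> (g x, g y) \<in> act g N"
      using K by (simp only: act_def restrict_apply if_True) (intro conjI img *)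
    then show ?thesis
      unfolding cut_order_def using act_mem[OF that(1)] K
      by (intro CollectI case_prodI conjI exI[of _ "g x"] exI[of _ "g y"] exI[of _ "g z"]) simp_all
  qed
  \<comment> \<open>The converse is \<open>act_mono\<close> for the inverse permutation.\<close>
  have act_mono_iff: "(act g L, act g M, act g N) \<in> cut_order K \<longleftrightarrow> (L, M, N) \<in> cut_order K"
    if "g \<in> G" "L \<in> K" "M \<in> K" "N \<in> K" for g L M N
    using act_mono[OF that(1), of L M N]
      act_mono[OF inv_mem[OF that(1)], of "act g L" "act g M" "act g N"] that
    by (auto simp: act_inv_left)
  have "act ` G \<subseteq> ?H"
    using act_Bij homeomorphic_map_act act_mono_iff
    by (auto simp: circular_Homeo_def circular_Aut_def circular_topology_cuts)
  moreover have "?H \<subseteq> Bij K" by (auto simp: circular_Homeo_def circular_Aut_def)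
  ultimately have "topological_group_embedding ((BijGroup X)\<lparr>carrier := G\<rparr>) (pointwise_topology X G)
    ((BijGroup K)\<lparr>carrier := ?H\<rparr>) (compact_open_topology (cut_topology K) (cut_topology K) ?H) act"
    by (rule topological_group_embedding_act)
  moreover have "(BijGroup K)\<lparr>carrier := ?H\<rparr> = circular_Homeo K (cut_order K)"
    by (simp add: circular_Homeo_def)
  moreover have "compact_circularly_ordered_space K (cut_order K)"
    using circular_order_cut_order compact_cuts
    by (simp add: compact_circularly_ordered_space_def circular_topology_cuts)
  ultimately show ?thesis
    unfolding c_orderly_def circular_Aut_carrier_update circular_topology_cuts[symmetric]
    using topological_group by auto
qed

end

text \<open>The type arguments are the types of the cuts: subsets of \<open>X\<close> in the linear
  case, binary relations on \<open>X\<close> in the circular one.\<close>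

theorem corollary3p7:
  shows "(\<forall>(X :: 'a set) r G. linear_order_on X r \<and> subgroup G (linear_Aut X r) \<longrightarrow>
            orderly TYPE('a set) ((linear_Aut X r)\<lparr>carrier := G\<rparr>) (pointwise_topology X G)) \<and>
         (\<forall>(X :: 'b set) R G. circular_order_on X R \<and> subgroup G (circular_Aut X R) \<longrightarrow>
            c_orderly TYPE(('b \<times> 'b) set) ((circular_Aut X R)\<lparr>carrier := G\<rparr>) (pointwise_topology X G))"
  using linear_ordered_set.orderly[OF linear_ordered_set.intro]
    circular_ordered_set.c_orderly[OF circular_ordered_set.intro] by blast

end
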